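(* Let $R$ be a connected quotient root system with base $S$ and positive roots $R^+$, and let $R^+ = \Phi_1 \sqcup \Phi_2 \sqcup \cdots \sqcup \Phi_n$ be a decomposition of $R^+$ into non-empty pairwise disjoint inversion sets $\Phi_1,\dots,\Phi_n$, where $\Phi_1$ contains the highest root of $R$. Suppose the canonical form of $\Phi_1$ is $\Phi_1 = \inf_I^S(\Psi, X_1)$. Then, after relabelling $\Phi_2,\dots,\Phi_n$, there are subsets $X_2,\dots,X_n \subseteq R_I^+$ such that $\Phi_2 = \inf_I^S(\Psi^c, X_2)$ and $\Phi_i = \inf_I^S(\emptyset, X_i)$ for all $i > 2$, where $\Psi^c = (R/I)^+ \setminus \Psi$.
   Context: Quotient root systems (QRS): let $\Delta$ be a root system in a Euclidean space $E$ with base $\Sigma$. For $J \subsetneq \Sigma$ identify $E/\mathrm{span}\,J$ with the orthogonal complement of $\mathrm{span}\,J$ (with induced inner product $\langle\cdot,\cdot\rangle$) and let $\pi_J$ be the projection; the QRS $\Delta/J$ is the set $\{\pi_J(\beta) : \beta \in \Delta \setminus \mathrm{span}\,J\}$ (its elements are called roots). A QRS $R$ has a base $S$ (the images of $\Sigma\setminus J$), which is a basis of the ambient space such that every root is an integer combination of $S$ with all coefficients $\ge 0$ (positive roots, forming $R^+$) or all $\le 0$. $R$ is connected if the graph on $S$ with an edge between $\theta,\theta'$ iff $\langle\theta,\theta'\rangle<0$ is connected. The coefficient order: $\alpha\le\beta$ iff $\beta-\alpha$ has all coefficients $\ge0$ in $S$; the highest root is the unique maximal element of $R^+$ for this order.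 For $K \subseteq S$: $R_K = R \cap \mathrm{span}\,K$ (a QRS with base $K$), $R_K^+ = R_K \cap R^+$; $\pi_K$ is the orthogonal projection onto $(\mathrm{span}\,K)^\perp$, $R/K$ is the set of non-zero elements of $\pi_K(R)$, a QRS with base the images of $S\setminus K$ and positive roots $(R/K)^+ = \pi_K(R^+)\setminus\{0\}$ (for $K=S$ it is empty). A subset $\Phi\subseteq R^+$ is closed if $\alpha,\beta\in\Phi$, $\alpha+\beta\in R$ imply $\alpha+\beta\in\Phi$; co-closed if its complement $\Phi^c=R^+\setminus\Phi$ is closed; an inversion set if both closed and co-closed. Inflation: for $K\subseteq S$, $\Psi\subseteq (R/K)^+$, $X \subseteq R_K^+$, $\inf_K^S(\Psi,X) := \{\alpha\in R^+ : \pi_K(\alpha)\in\Psi\} \cup X$. A subset $\Phi\subseteq R^+$ is primitive if $\Phi\ne\emptyset$, $\Phi\ne R^+$, and $\Phi = \inf_K^S(\Psi,X)$ for some $\Psi, X$ implies $K=\emptyset$ or $K=S$ (the same notion applies inside any QRS, e.g. $R/K$). Canonical form: for connected $R$ and $\Phi\subseteq R^+$ there is a unique expression $\Phi=\inf_I^S(\Psi,X)$ with $I\subsetneq S$ such that either $\Psi$ is primitive (in $R/I$), or $\Psi\in\{\emptyset,(R/I)^+\}$ and $I$ is smallest (under inclusion) with this property; this is called the canonical form of $\Phi$. *)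

theory Defs
  imports "HOL-Analysis.Analysis"
begin

definition refl_vec :: "'a::euclidean_space \<Rightarrow> 'a \<Rightarrow> 'a" where
  "refl_vec \<alpha> \<beta> = \<beta> - ((2 * (\<beta> \<bullet> \<alpha>)) / (\<alpha> \<bullet> \<alpha>)) *\<^sub>R \<alpha>"

definition root_system :: "'a::euclidean_space set \<Rightarrow> bool" where
  "root_system \<Delta> \<longleftrightarrow>
     finite \<Delta> \<and> span \<Delta> = UNIV \<and> 0 \<notin> \<Delta> \<and>
     (\<forall>\<alpha>\<in>\<Delta>. \<forall>c::real. c *\<^sub>R \<alpha> \<in> \<Delta> \<longleftrightarrow> c = 1 \<or> c = -1) \<and>
     (\<forall>\<alpha>\<in>\<Delta>. \<forall>\<beta>\<in>\<Delta>. refl_vec \<alpha> \<beta> \<in> \<Delta>) \<and>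
     (\<forall>\<alpha>\<in>\<Delta>. \<forall>\<beta>\<in>\<Delta>. (2 * (\<beta> \<bullet> \<alpha>)) / (\<alpha> \<bullet> \<alpha>) \<in> \<int>)"

definition nonneg_int_comb :: "'a::euclidean_space set \<Rightarrow> 'a \<Rightarrow> bool" where
  "nonneg_int_comb B v \<longleftrightarrow>
     (\<exists>c::'a \<Rightarrow> int. (\<forall>s\<in>B. c s \<ge> 0) \<and> v = (\<Sum>s\<in>B. of_int (c s) *\<^sub>R s))"

definition root_base :: "'a::euclidean_space set \<Rightarrow> 'a set \<Rightarrow> bool" where
  "root_base \<Delta> \<Sigma> \<longleftrightarrow> \<Sigma> \<subseteq> \<Delta> \<and> independent \<Sigma> \<and>
     (\<forall>\<beta>\<in>\<Delta>. nonneg_int_comb \<Sigma> \<beta> \<or> nonneg_int_comb \<Sigma> (- \<beta>))"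

definition qproj :: "'a::euclidean_space set \<Rightarrow> 'a \<Rightarrow> 'a" where
  "qproj K x = x - (THE p. p \<in> span K \<and> (\<forall>y\<in>span K. (x - p) \<bullet> y = 0))"

definition qrs :: "'a::euclidean_space set \<Rightarrow> 'a set \<Rightarrow> bool" where
  "qrs R S \<longleftrightarrow> (\<exists>\<Delta> \<Sigma> J. root_system \<Delta> \<and> root_base \<Delta> \<Sigma> \<and> J \<subset> \<Sigma> \<and>
      R = qproj J ` (\<Delta> - span J) \<and> S = qproj J ` (\<Sigma> - J))"

definition pos :: "'a::euclidean_space set \<Rightarrow> 'a set \<Rightarrow> 'a set" where
  "pos R S = {\<alpha> \<in> R. nonneg_int_comb S \<alpha>}"

definition qrs_connected :: "'a::euclidean_space set \<Rightarrow> bool" where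
  "qrs_connected S \<longleftrightarrow>
     (\<forall>\<theta>\<in>S. \<forall>\<theta>'\<in>S. (\<lambda>x y. x \<in> S \<and> y \<in> S \<and> x \<bullet> y < 0)\<^sup>*\<^sup>* \<theta> \<theta>')"

definition coef_le :: "'a::euclidean_space set \<Rightarrow> 'a \<Rightarrow> 'a \<Rightarrow> bool" where
  "coef_le S \<alpha> \<beta> \<longleftrightarrow> nonneg_int_comb S (\<beta> - \<alpha>)"

definition highest_root :: "'a::euclidean_space set \<Rightarrow> 'a set \<Rightarrow> 'a \<Rightarrow> bool" where
  "highest_root R S h \<longleftrightarrow> h \<in> pos R S \<and> (\<forall>\<alpha>\<in>pos R S. coef_le S \<alpha> h)"

definition sub_rs :: "'a::euclidean_space set \<Rightarrow> 'a set \<Rightarrow> 'a set" where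
  "sub_rs R K = R \<inter> span K"

definition quot_rs :: "'a::euclidean_space set \<Rightarrow> 'a set \<Rightarrow> 'a set" where
  "quot_rs R K = qproj K ` R - {0}"

definition quot_base :: "'a::euclidean_space set \<Rightarrow> 'a set \<Rightarrow> 'a set" where
  "quot_base S K = qproj K ` (S - K)"

definition closed_rs :: "'a::euclidean_space set \<Rightarrow> 'a set \<Rightarrow> bool" where
  "closed_rs R \<Phi> \<longleftrightarrow> (\<forall>\<alpha>\<in>\<Phi>. \<forall>\<beta>\<in>\<Phi>. \<alpha> + \<beta> \<in> R \<longrightarrow> \<alpha> + \<beta> \<in> \<Phi>)"

definition inversion_set :: "'a::euclidean_space set \<Rightarrow> 'a set \<Rightarrow> 'a set \<Rightarrow> bool" where
  "inversion_set R S \<Phi> \<longleftrightarrow> \<Phi> \<subseteq> pos R S \<and> closed_rs R \<Phi> \<and> closed_rs R (pos R S - \<Phi>)"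

definition infl :: "'a::euclidean_space set \<Rightarrow> 'a set \<Rightarrow> 'a set \<Rightarrow> 'a set \<Rightarrow> 'a set \<Rightarrow> 'a set" where
  "infl R S K \<Psi> X = {\<alpha> \<in> pos R S. qproj K \<alpha> \<in> \<Psi>} \<union> X"

definition primitive :: "'a::euclidean_space set \<Rightarrow> 'a set \<Rightarrow> 'a set \<Rightarrow> bool" where
  "primitive R S \<Phi> \<longleftrightarrow> \<Phi> \<subseteq> pos R S \<and> \<Phi> \<noteq> {} \<and> \<Phi> \<noteq> pos R S \<and>
     (\<forall>K \<Psi> X. K \<subseteq> S \<and> \<Psi> \<subseteq> pos (quot_rs R K) (quot_base S K) \<and>
        X \<subseteq> sub_rs R K \<inter> pos R S \<and> \<Phi> = infl R S K \<Psi> X \<longrightarrow> K = {} \<or> K = S)"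

definition canonical_form ::
  "'a::euclidean_space set \<Rightarrow> 'a set \<Rightarrow> 'a set \<Rightarrow> 'a set \<Rightarrow> 'a set \<Rightarrow> 'a set \<Rightarrow> bool" where
  "canonical_form R S \<Phi> I \<Psi> X \<longleftrightarrow>
     I \<subset> S \<and> \<Psi> \<subseteq> pos (quot_rs R I) (quot_base S I) \<and> X \<subseteq> sub_rs R I \<inter> pos R S \<and>
     \<Phi> = infl R S I \<Psi> X \<and>
     (primitive (quot_rs R I) (quot_base S I) \<Psi> \<or>
      (\<Psi> \<in> {{}, pos (quot_rs R I) (quot_base S I)} \<and>
       (\<forall>I' \<Psi>' X'. I' \<subset> S \<and> \<Psi>' \<in> {{}, pos (quot_rs R I') (quot_base S I')} \<and>
          X' \<subseteq> sub_rs R I' \<inter> pos R S \<and> \<Phi> = infl R S I' \<Psi>' X' \<longrightarrow> I \<subseteq> I')))"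

end

theory Submission
  imports Defs
begin

text \<open>Unions of parts are again inversion sets, so three parts \<open>A \<ni> h\<close>, \<open>B\<close>, \<open>C\<close> suffice: if \<open>A\<close> is
  inflated from \<open>I\<close> with \<open>\<Psi>\<close> primitive, then \<open>B\<close> or \<open>C\<close> lies in \<open>span I\<close>. This is an analogue of
  Gallai's theorem on edge colourings without rainbow triangles. First, \<open>B\<close> or \<open>C\<close>, say \<open>C\<close>, has
  support \<open>K \<noteq> S\<close>. Second, \<open>A\<close> is then inflated from \<open>K\<close>: the roots \<open>\<kappa>\<close> of \<open>span K\<close> for which
  membership in \<open>A\<close> is preserved under addition of \<open>\<kappa>\<close> form a symmetric closed set containing
  \<open>C\<close>, and such a set contains the whole support of \<open>C\<close>. Third, inflation from \<open>I\<close> and from \<open>K\<close>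
  contradicts primitivity unless \<open>K \<subseteq> I\<close>. Everything rests on one property of quotient root
  systems: if \<open>a \<bullet> b < 0\<close> for roots \<open>a\<close>, \<open>b\<close>, then \<open>a + b\<close> is a root or \<open>0\<close>.\<close>

section \<open>Orthogonal projections\<close>

text \<open>Justifies the definite description in \<open>qproj\<close>. Two candidates differ by an
  element of \<open>span K\<close> that is orthogonal to itself.\<close>

lemma qproj_ex1:
  fixes x :: "'a::euclidean_space"
  shows "\<exists>!p. p \<in> span K \<and> (\<forall>y\<in>span K. (x - p) \<bullet> y = 0)"
proof -
  obtain y z where yz: "y \<in> span K" "\<And>w. w \<in> span K \<Longrightarrow> orthogonal z w" "x = y + z"
    using orthogonal_subspace_decomp_exists[of K x] by metis
  show ?thesis
  proof (rule ex1I[of _ y])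
    show "y \<in> span K \<and> (\<forall>w\<in>span K. (x - y) \<bullet> w = 0)"
      using yz by (auto simp: orthogonal_def)
    fix p assume p: "p \<in> span K \<and> (\<forall>w\<in>span K. (x - p) \<bullet> w = 0)"
    have m: "p - y \<in> span K" using p yz by (simp add: span_diff)
    have "(x - p) \<bullet> (p - y) = 0" "(x - y) \<bullet> (p - y) = 0"
      using p m yz by (auto simp: orthogonal_def)
    then have "(p - y) \<bullet> (p - y) = 0" by (simp add: inner_diff_left)
    then show "p = y" by simp
  qed
qed

lemma qproj_diff_mem: "x - qproj K x \<in> span K"
  and qproj_orth: "y \<in> span K \<Longrightarrow> qproj K x \<bullet> y = 0"
  using theI'[OF qproj_ex1[of K x]] by (auto simp: qproj_def)

lemma qproj_eqI:
  assumes "x - z \<in> span K" "\<And>y. y \<in> span K \<Longrightarrow> z \<bullet> y = 0"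
  shows "qproj K x = z"
proof -
  have "(THE p. p \<in> span K \<and> (\<forall>y\<in>span K. (x - p) \<bullet> y = 0)) = x - z"
    by (rule the1_equality[OF qproj_ex1]) (use assms in auto)
  then show ?thesis by (simp add: qproj_def)
qed

lemma qproj_linear: "linear (qproj K)"
proof
  fix x y
  show "qproj K (x + y) = qproj K x + qproj K y"
  proof (rule qproj_eqI)
    have e: "x + y - (qproj K x + qproj K y) = (x - qproj K x) + (y - qproj K y)" by simp
    show "x + y - (qproj K x + qproj K y) \<in> span K"
      unfolding e by (intro span_add qproj_diff_mem)
  qed (simp add: inner_add_left qproj_orth)
next
  fix c x
  show "qproj K (c *\<^sub>R x) = c *\<^sub>R qproj K x"
  proof (rule qproj_eqI)
    show "c *\<^sub>R x - c *\<^sub>R qproj K x \<in> span K"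
      using span_scale[OF qproj_diff_mem[of x K]] by (simp add: scaleR_diff_right)
  qed (simp add: qproj_orth)
qed

lemmas qproj_add = linear_add[OF qproj_linear]
  and qproj_diff = linear_diff[OF qproj_linear]
  and qproj_neg = linear_neg[OF qproj_linear]
  and qproj_sum = linear_sum[OF qproj_linear]
  and qproj_scale = linear_scale[OF qproj_linear]

lemma qproj_eq_0_iff: "qproj K x = 0 \<longleftrightarrow> x \<in> span K"
  using qproj_diff_mem[of x K] qproj_eqI[of x 0 K] by auto

lemma qproj_eq_iff: "qproj K x = qproj K y \<longleftrightarrow> x - y \<in> span K"
  by (metis qproj_diff qproj_eq_0_iff right_minus_eq)

text \<open>Lets an inner product in the quotient be computed with any lift: \<open>a\<close> and
  its projection differ by an element of \<open>span K\<close>, to which \<open>b\<close> is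
  orthogonal.\<close>

lemma qproj_inner_right:
  fixes a b :: "'a::euclidean_space"
  assumes "\<And>y. y \<in> span K \<Longrightarrow> b \<bullet> y = 0"
  shows "qproj K a \<bullet> b = a \<bullet> b"
proof -
  have "(a - qproj K a) \<bullet> b = 0"
    using assms[OF qproj_diff_mem[of a K]] by (simp add: inner_commute)
  then show ?thesis by (simp add: inner_diff_left)
qed

text \<open>Pulls spans back along the projection, as needed for iterated quotients. The elements of
  \<open>I\<close> are killed, so removing them from \<open>H\<close> does not change the span of
  the image.\<close>

lemma qproj_mem_span_image:
  assumes "I \<subseteq> H"
  shows "qproj I v \<in> span (qproj I ` (H - I)) \<longleftrightarrow> v \<in> span H"
proof
  assume "qproj I v \<in> span (qproj I ` (H - I))"
  then obtain w where w: "w \<in> span (H - I)" "qproj I v = qproj I w"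
    by (auto simp: linear_span_image[OF qproj_linear])
  then have "v - w \<in> span I" by (simp add: qproj_eq_iff)
  moreover have "span I \<subseteq> span H" "span (H - I) \<subseteq> span H"
    using assms by (intro span_mono; blast)+
  ultimately have "(v - w) + w \<in> span H" using w by (intro span_add) auto
  then show "v \<in> span H" by simp
next
  assume "v \<in> span H"
  then have "qproj I v \<in> span (qproj I ` H)"
    by (auto simp: linear_span_image[OF qproj_linear])
  moreover have "qproj I ` H \<subseteq> insert 0 (qproj I ` (H - I))"
    by (auto simp: qproj_eq_0_iff span_base)
  ultimately have "qproj I v \<in> span (insert 0 (qproj I ` (H - I)))"
    using span_mono by blast
  then show "qproj I v \<in> span (qproj I ` (H - I))" by simp
qed

lemma nonneg_int_comb_qproj:
  assumes "finite B" "nonneg_int_comb B v"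
  shows "nonneg_int_comb (qproj K ` (B - K)) (qproj K v)"
proof -
  obtain c :: "'a \<Rightarrow> int" where c: "\<forall>s\<in>B. c s \<ge> 0" "v = (\<Sum>s\<in>B. of_int (c s) *\<^sub>R s)"
    using assms(2) by (auto simp: nonneg_int_comb_def)
  let ?f = "qproj K" and ?D = "B - K"
  \<comment> \<open>Elements of \<open>B - K\<close> with the same image are grouped, and their
    coefficients are added.\<close>
  define d where "d t = (\<Sum>s | s \<in> ?D \<and> ?f s = t. c s)" for t
  have "?f v = (\<Sum>s\<in>B. of_int (c s) *\<^sub>R ?f s)"
    by (simp add: c(2) qproj_sum qproj_scale)
  also have "\<dots> = (\<Sum>s\<in>?D. of_int (c s) *\<^sub>R ?f s)"
    by (rule sum.mono_neutral_right) (use assms in \<open>auto simp: qproj_eq_0_iff span_base\<close>)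
  also have "\<dots> = (\<Sum>t\<in>?f ` ?D. \<Sum>s | s \<in> ?D \<and> ?f s = t. of_int (c s) *\<^sub>R ?f s)"
    by (rule sum.image_gen) (use assms in auto)
  also have "\<dots> = (\<Sum>t\<in>?f ` ?D. of_int (d t) *\<^sub>R t)"
    by (rule sum.cong) (auto simp: d_def scaleR_sum_left)
  finally have "?f v = (\<Sum>t\<in>?f ` ?D. of_int (d t) *\<^sub>R t)" .
  moreover have "\<forall>t\<in>?f ` ?D. d t \<ge> 0"
    using c(1) by (auto simp: d_def intro!: sum_nonneg)
  ultimately show ?thesis by (auto simp: nonneg_int_comb_def)
qed

section \<open>Quotient root systems\<close>

lemma root_systemD:
  assumes "root_system \<Delta>"
  shows "finite \<Delta>" "0 \<notin> \<Delta>"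
    and "a \<in> \<Delta> \<Longrightarrow> c *\<^sub>R a \<in> \<Delta> \<Longrightarrow> c = 1 \<or> c = -1"
    and "a \<in> \<Delta> \<Longrightarrow> - a \<in> \<Delta>"
    and "a \<in> \<Delta> \<Longrightarrow> b \<in> \<Delta> \<Longrightarrow> refl_vec a b \<in> \<Delta>"
    and "a \<in> \<Delta> \<Longrightarrow> b \<in> \<Delta> \<Longrightarrow> 2 * (b \<bullet> a) / (a \<bullet> a) \<in> \<int>"
proof -
  assume "a \<in> \<Delta>"
  then have "(-1) *\<^sub>R a \<in> \<Delta>" using assms unfolding root_system_def by blast
  then show "- a \<in> \<Delta>" by simp
qed (use assms in \<open>(unfold root_system_def, blast)+\<close>)

text \<open>The Cartan integers \<open>p\<close> and \<open>q\<close> are negative. If one of them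
  is -1, a reflection produces the sum. Otherwise their product is at least 4, which forces equality
  in the Cauchy-Schwarz inequality; then \<open>b = - a\<close> and the sum vanishes.\<close>

lemma root_system_add:
  assumes \<Delta>: "root_system \<Delta>" and a: "a \<in> \<Delta>" and b: "b \<in> \<Delta>" and neg: "a \<bullet> b < 0"
  shows "a + b \<in> \<Delta> \<union> {0}"
proof -
  have "a \<noteq> 0" "b \<noteq> 0" using neg by auto
  then have pos: "a \<bullet> a > 0" "b \<bullet> b > 0" by auto
  define p q where "p = 2 * (b \<bullet> a) / (a \<bullet> a)" and "q = 2 * (a \<bullet> b) / (b \<bullet> b)"
  have pZ: "p \<in> \<int>" and qZ: "q \<in> \<int>"
    using root_systemD(6)[OF \<Delta>] a b by (auto simp: p_def q_def)
  have p0: "p < 0" and q0: "q < 0"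
    unfolding p_def q_def using neg pos
    by (simp_all add: inner_commute[of b a] divide_neg_pos)
  consider "p = -1" | "q = -1" | "p \<le> -2" "q \<le> -2"
  proof -
    obtain i where i: "p = of_int i" using pZ by (auto elim: Ints_cases)
    obtain j where j: "q = of_int j" using qZ by (auto elim: Ints_cases)
    have "i < 0" "j < 0" using p0 q0 i j by auto
    then have "i = -1 \<or> j = -1 \<or> (i \<le> -2 \<and> j \<le> -2)" by linarith
    then show ?thesis using that i j by fastforce
  qed
  then show ?thesis
  proof cases
    case 1
    have "refl_vec a b = a + b"
      using 1 unfolding p_def by (simp add: refl_vec_def)
    then show ?thesis using root_systemD(5)[OF \<Delta> a b] by simp
  next
    case 2
    have "refl_vec b a = a + b"
      using 2 unfolding q_def by (simp add: refl_vec_def)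
    then show ?thesis using root_systemD(5)[OF \<Delta> b a] by simp
  next
    case 3
    have "p * q \<ge> 2 * 2" using mult_mono[of 2 "-p" 2 "-q"] 3 by simp
    moreover have "p * q = 4 * (a \<bullet> b)\<^sup>2 / ((a \<bullet> a) * (b \<bullet> b))"
      by (simp add: p_def q_def power2_eq_square inner_commute)
    ultimately have "(a \<bullet> b)\<^sup>2 \<ge> (a \<bullet> a) * (b \<bullet> b)"
      using pos by (simp add: field_simps)
    then have eq: "(a \<bullet> b)\<^sup>2 = (a \<bullet> a) * (b \<bullet> b)"
      using Cauchy_Schwarz_ineq[of a b] by linarith
    define c where "c = (a \<bullet> b) / (a \<bullet> a)"
    have "(b - c *\<^sub>R a) \<bullet> (b - c *\<^sub>R a) = b \<bullet> b - 2 * c * (a \<bullet> b) + c\<^sup>2 * (a \<bullet> a)"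
      by (simp add: inner_diff_left inner_diff_right inner_commute power2_eq_square algebra_simps)
    also have "\<dots> = b \<bullet> b - (a \<bullet> b)\<^sup>2 / (a \<bullet> a)"
      using pos by (simp add: c_def power2_eq_square field_simps)
    also have "\<dots> = 0" using eq pos by (simp add: field_simps)
    finally have bc: "b = c *\<^sub>R a" by simp
    then have "c = 1 \<or> c = -1" using root_systemD(3)[OF \<Delta> a] b by blast
    moreover have "c < 0" using neg pos by (simp add: c_def divide_neg_pos)
    ultimately have "c = -1" by auto
    then show ?thesis using bc by simp
  qed
qed

lemma refl_vec_involutive: "a \<bullet> a \<noteq> 0 \<Longrightarrow> refl_vec a (refl_vec a x) = x"
proof -
  assume a: "a \<bullet> a \<noteq> 0"
  define c where "c = 2 * (x \<bullet> a) / (a \<bullet> a)"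
  have y: "refl_vec a x = x - c *\<^sub>R a" by (simp add: refl_vec_def c_def)
  have "2 * ((x - c *\<^sub>R a) \<bullet> a) / (a \<bullet> a) = - c"
    using a by (simp add: inner_diff_left c_def field_simps)
  then show ?thesis unfolding y by (simp add: refl_vec_def)
qed

text \<open>The sum of a fibre is invariant under the reflections in \<open>J\<close>, so the roots of the fibre
  over \<open>\<beta>\<close> average to \<open>\<beta>\<close>; this lifts a negative inner product to the root system.\<close>

lemma quotient_fibre_sum:
  assumes \<Delta>: "root_system \<Delta>" and J: "J \<subseteq> \<Delta>"
  defines "F \<beta> \<equiv> {b \<in> \<Delta>. qproj J b = \<beta>}"
  shows "(\<Sum>b\<in>F \<beta>. b) = of_nat (card (F \<beta>)) *\<^sub>R \<beta>"
proof -
  let ?v = "\<Sum>b\<in>F \<beta>. b"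
  have orthJ: "?v \<bullet> j = 0" if j: "j \<in> J" for j
  proof -
    have j0: "j \<bullet> j \<noteq> 0" using J j root_systemD(2)[OF \<Delta>] by auto
    have into: "refl_vec j b \<in> F \<beta>" if "b \<in> F \<beta>" for b
    proof -
      have "refl_vec j b \<in> \<Delta>" using root_systemD(5)[OF \<Delta>] J j that by (auto simp: F_def)
      moreover have "qproj J (refl_vec j b) = qproj J b"
        by (simp add: qproj_eq_iff refl_vec_def span_neg span_scale span_base j)
      ultimately show ?thesis using that by (simp add: F_def)
    qed
    have "bij_betw (refl_vec j) (F \<beta>) (F \<beta>)"
      by (rule bij_betw_byWitness[where f' = "refl_vec j"])
        (use into j0 in \<open>auto simp: refl_vec_involutive\<close>)
    then have "?v = (\<Sum>b\<in>F \<beta>. refl_vec j b)"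
      by (rule sum.reindex_bij_betw[symmetric, of _ _ _ "\<lambda>b. b"])
    also have "\<dots> = ?v - (\<Sum>b\<in>F \<beta>. (2 * (b \<bullet> j) / (j \<bullet> j)) *\<^sub>R j)"
      by (simp add: refl_vec_def sum_subtractf)
    also have "(\<Sum>b\<in>F \<beta>. (2 * (b \<bullet> j) / (j \<bullet> j)) *\<^sub>R j) = (2 * (?v \<bullet> j) / (j \<bullet> j)) *\<^sub>R j"
      by (simp add: inner_sum_left sum_distrib_left sum_divide_distrib scaleR_sum_left)
    finally show ?thesis using j0 by auto
  qed
  have "?v \<bullet> y = 0" if "y \<in> span J" for y
    using that
  proof (induction rule: span_induct)
    case base then show ?case by (auto simp: subspace_def inner_right_distrib)
  qed (rule orthJ)
  then have "?v = qproj J ?v" by (intro qproj_eqI[symmetric]) (auto simp: span_zero)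
  also have "\<dots> = (\<Sum>b\<in>F \<beta>. \<beta>)" by (simp add: qproj_sum F_def)
  finally show ?thesis by (simp add: scaleR_conv_of_real sum_constant_scaleR)
qed

text \<open>Collects the properties of quotient root systems from which everything below is derived.
  Quotients are in general not stable under reflections, so \<open>add\<close> takes over their
  role.\<close>

locale root_like =
  fixes R S :: "'a::euclidean_space set"
  assumes fin: "finite R" and zero: "0 \<notin> R" and neg: "a \<in> R \<Longrightarrow> - a \<in> R"
    and base: "S \<subseteq> R" and ind: "independent S"
    and sgn: "a \<in> R \<Longrightarrow> nonneg_int_comb S a \<or> nonneg_int_comb S (- a)"
    and add: "a \<in> R \<Longrightarrow> b \<in> R \<Longrightarrow> a \<bullet> b < 0 \<Longrightarrow> a + b \<in> R \<union> {0}"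

lemma qrs_root_like:
  assumes "qrs R S" shows "root_like R S"
proof -
  obtain \<Delta> \<Sigma> J where \<Delta>: "root_system \<Delta>" and \<Sigma>: "root_base \<Delta> \<Sigma>" and J: "J \<subset> \<Sigma>"
    and R: "R = qproj J ` (\<Delta> - span J)" and S: "S = qproj J ` (\<Sigma> - J)"
    using assms by (auto simp: qrs_def)
  have fin\<Delta>: "finite \<Delta>" by (rule root_systemD(1)[OF \<Delta>])
  have \<Sigma>\<Delta>: "\<Sigma> \<subseteq> \<Delta>" and ind\<Sigma>: "independent \<Sigma>" using \<Sigma> by (auto simp: root_base_def)
  have fin\<Sigma>: "finite \<Sigma>" using fin\<Delta> \<Sigma>\<Delta> finite_subset by blast
  show ?thesis
  proof
    show "finite R" using fin\<Delta> R by simp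
    show "0 \<notin> R" by (auto simp: R) (metis qproj_eq_0_iff)
    show "- a \<in> R" if a: "a \<in> R" for a
    proof -
      obtain b where b: "b \<in> \<Delta>" "b \<notin> span J" "a = qproj J b" using a R by auto
      have "- b \<in> \<Delta> - span J"
        using b root_systemD(4)[OF \<Delta>] span_neg[of "-b" J] by auto
      then show ?thesis using b R by (auto simp: qproj_neg image_iff intro!: bexI[of _ "-b"])
    qed
    have notJ: "s \<notin> span J" if "s \<in> \<Sigma> - J" for s
    proof
      assume "s \<in> span J"
      moreover have "span J \<subseteq> span (\<Sigma> - {s})" using that J by (intro span_mono) auto
      ultimately show False using ind\<Sigma> that by (auto simp: dependent_def)
    qed
    show "S \<subseteq> R" using notJ \<Sigma>\<Delta> by (auto simp: R S)
    show "independent S"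
    proof (rule ccontr)
      have finD: "finite (\<Sigma> - J)" using fin\<Sigma> by simp
      have inj: "inj_on (qproj J) (\<Sigma> - J)"
      proof (rule inj_onI)
        fix x y assume x: "x \<in> \<Sigma> - J" and y: "y \<in> \<Sigma> - J" and eq: "qproj J x = qproj J y"
        show "x = y"
        proof (rule ccontr)
          assume ne: "x \<noteq> y"
          have "x - y \<in> span J" using eq by (simp add: qproj_eq_iff)
          moreover have "span J \<subseteq> span (\<Sigma> - {x})" using x J by (intro span_mono) auto
          moreover have "y \<in> span (\<Sigma> - {x})" using ne y by (auto intro: span_base)
          ultimately have "(x - y) + y \<in> span (\<Sigma> - {x})" by (intro span_add) auto
          then show False using ind\<Sigma> x by (auto simp: dependent_def)
        qed
      qed
      assume "\<not> independent S"
      then obtain u where u: "(\<Sum>v\<in>S. u v *\<^sub>R v) = 0" "\<exists>v\<in>S. u v \<noteq> 0"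
        using finD by (auto simp: S dependent_finite)
      \<comment> \<open>A linear relation among the images is lifted to \<open>\<Sigma>\<close>: the
        lift \<open>w\<close> lies in \<open>span J\<close>, and subtracting its expansion over
        \<open>J\<close> gives a non-trivial relation on \<open>\<Sigma>\<close> with coefficients
        \<open>c\<close>.\<close>
      define w where "w = (\<Sum>s\<in>\<Sigma> - J. u (qproj J s) *\<^sub>R s)"
      have "qproj J w = (\<Sum>v\<in>S. u v *\<^sub>R v)"
        by (simp add: w_def S qproj_sum qproj_scale sum.reindex[OF inj])
      then have "w \<in> span J" using u by (simp add: qproj_eq_0_iff)
      then obtain k where k: "w = (\<Sum>s\<in>J. k s *\<^sub>R s)"
        using span_finite[OF finite_subset[of J \<Sigma>]] J fin\<Sigma> by auto
      define c where "c s = (if s \<in> J then - k s else u (qproj J s))" for s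
      have "(\<Sum>s\<in>\<Sigma>. c s *\<^sub>R s) = (\<Sum>s\<in>\<Sigma> - J. c s *\<^sub>R s) + (\<Sum>s\<in>J. c s *\<^sub>R s)"
        using J fin\<Sigma> by (intro sum.subset_diff) auto
      also have "\<dots> = w - w"
        unfolding k[symmetric] by (subst (2) k) (simp add: w_def c_def sum_negf)
      finally have "(\<Sum>s\<in>\<Sigma>. c s *\<^sub>R s) = 0" by simp
      then have "\<forall>s\<in>\<Sigma>. c s = 0" using ind\<Sigma> fin\<Sigma> by (auto simp: dependent_finite)
      then show False using u(2) by (auto simp: S c_def)
    qed
    show "nonneg_int_comb S a \<or> nonneg_int_comb S (- a)" if a: "a \<in> R" for a
    proof -
      obtain b where b: "b \<in> \<Delta>" "a = qproj J b" using a R by auto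
      then have "nonneg_int_comb \<Sigma> b \<or> nonneg_int_comb \<Sigma> (- b)"
        using \<Sigma> by (auto simp: root_base_def)
      then show ?thesis
        using nonneg_int_comb_qproj[OF fin\<Sigma>, of b J] nonneg_int_comb_qproj[OF fin\<Sigma>, of "-b" J]
        by (auto simp: b S qproj_neg)
    qed
    show "a + b \<in> R \<union> {0}" if a: "a \<in> R" and b: "b \<in> R" and ab: "a \<bullet> b < 0" for a b
    proof -
      obtain a' where a': "a' \<in> \<Delta>" "a = qproj J a'" using a R by auto
      \<comment> \<open>The lifts of \<open>b\<close> sum to a positive multiple of
        \<open>b\<close>, so one of them, \<open>x\<close>, has negative product with
        \<open>a'\<close>. The root or zero \<open>a' + x\<close> then projects to
        \<open>a + b\<close>.\<close>
      let ?F = "{x \<in> \<Delta>. qproj J x = b}"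
      obtain b' where "b' \<in> ?F" using b R by auto
      then have "card ?F > 0" using fin\<Delta> by (auto simp: card_gt_0_iff)
      moreover have "a' \<bullet> b = a \<bullet> b"
      proof -
        obtain b0 where "b = qproj J b0" using b R by auto
        then show ?thesis unfolding a' by (intro qproj_inner_right[symmetric]) (simp add: qproj_orth)
      qed
      ultimately have "a' \<bullet> (\<Sum>x\<in>?F. x) < 0"
        using quotient_fibre_sum[OF \<Delta>, of J b] J \<Sigma>\<Delta> ab by (simp add: mult_pos_neg)
      then have "(\<Sum>x\<in>?F. a' \<bullet> x) < 0" by (simp add: inner_sum_right)
      then obtain x where x: "x \<in> ?F" "a' \<bullet> x < 0"
        by (metis (no_types, lifting) not_less sum_nonneg)
      have "a' + x \<in> \<Delta> \<union> {0}" using root_system_add[OF \<Delta> a'(1) _ x(2)] x by auto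
      moreover have "qproj J (a' + x) = a + b" using x a' by (simp add: qproj_add)
      ultimately show ?thesis
      proof (cases "a' + x \<in> span J")
        case True
        then have "qproj J (a' + x) = 0" by (simp add: qproj_eq_0_iff)
        then show ?thesis using \<open>qproj J (a' + x) = a + b\<close> by simp
      next
        case False
        then have "a' + x \<in> \<Delta> - span J"
          using \<open>a' + x \<in> \<Delta> \<union> {0}\<close> by (auto simp: span_zero)
        then show ?thesis using \<open>qproj J (a' + x) = a + b\<close> R by (metis UnI1 imageI)
      qed
    qed
  qed
qed

section \<open>Coordinates and root addition\<close>

context root_like
begin

abbreviation P where "P \<equiv> pos R S"
abbreviation cf where "cf \<equiv> representation S"

definition ht where "ht v = (\<Sum>s\<in>S. cf v s)"
text \<open>Integrality of the differences is left out because roots have integer coordinates;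
  between roots this agrees with \<open>coef_le S\<close>.\<close>

definition le where "le a b \<longleftrightarrow> (\<forall>s\<in>S. cf a s \<le> cf b s)"

lemma finS: "finite S"
  using base fin finite_subset by blast

lemma sum_cf: "v \<in> span S \<Longrightarrow> (\<Sum>s\<in>S. cf v s *\<^sub>R s) = v"
  by (rule real_vector.sum_representation_eq) (use ind finS in auto)

lemma cf_sum: "s \<in> S \<Longrightarrow> cf (\<Sum>t\<in>S. f t *\<^sub>R t) s = f s"
proof -
  assume s: "s \<in> S"
  let ?v = "\<Sum>t\<in>S. f t *\<^sub>R t"
  have "?v \<in> span S" by (intro span_sum span_scale span_base)
  then have "(\<Sum>t\<in>S. (cf ?v t - f t) *\<^sub>R t) = 0"
    using sum_cf[of ?v] by (simp add: scaleR_diff_left sum_subtractf)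
  then have "\<forall>t\<in>S. cf ?v t - f t = 0"
    using real_vector.independentD[OF ind finS subset_refl, of "\<lambda>t. cf ?v t - f t"] by blast
  then show ?thesis using s by simp
qed

lemma nonneg_int_comb_iff:
  "nonneg_int_comb S v \<longleftrightarrow> v \<in> span S \<and> (\<forall>s\<in>S. cf v s \<in> \<int> \<and> 0 \<le> cf v s)"
proof
  assume "nonneg_int_comb S v"
  then obtain c :: "'a \<Rightarrow> int" where c: "\<forall>s\<in>S. c s \<ge> 0" "v = (\<Sum>s\<in>S. of_int (c s) *\<^sub>R s)"
    by (auto simp: nonneg_int_comb_def)
  have "v \<in> span S" unfolding c(2) by (intro span_sum span_scale span_base)
  moreover have "cf v s = of_int (c s)" if "s \<in> S" for s
    unfolding c(2) using that by (rule cf_sum)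
  ultimately show "v \<in> span S \<and> (\<forall>s\<in>S. cf v s \<in> \<int> \<and> 0 \<le> cf v s)" using c(1) by auto
next
  assume v: "v \<in> span S \<and> (\<forall>s\<in>S. cf v s \<in> \<int> \<and> 0 \<le> cf v s)"
  then have "(\<Sum>s\<in>S. of_int \<lfloor>cf v s\<rfloor> *\<^sub>R s) = (\<Sum>s\<in>S. cf v s *\<^sub>R s)"
    by (intro sum.cong) auto
  then have "v = (\<Sum>s\<in>S. of_int \<lfloor>cf v s\<rfloor> *\<^sub>R s)" using v by (simp add: sum_cf)
  then show "nonneg_int_comb S v"
    unfolding nonneg_int_comb_def using v by (intro exI[of _ "\<lambda>s. \<lfloor>cf v s\<rfloor>"]) auto
qed

lemma cf_add: "u \<in> span S \<Longrightarrow> v \<in> span S \<Longrightarrow> cf (u + v) s = cf u s + cf v s"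
  and cf_diff: "u \<in> span S \<Longrightarrow> v \<in> span S \<Longrightarrow> cf (u - v) s = cf u s - cf v s"
  and cf_neg: "u \<in> span S \<Longrightarrow> cf (- u) s = - cf u s"
  using real_vector.representation_add[OF ind, of v u] real_vector.representation_diff[OF ind, of v u]
    real_vector.representation_neg[OF ind, of u] by auto

lemma cf_base: "s \<in> S \<Longrightarrow> cf s t = (if t = s then 1 else 0)"
  by (simp add: real_vector.representation_basis[OF ind])

lemma R_span: "a \<in> R \<Longrightarrow> a \<in> span S"
  using sgn[of a] nonneg_int_comb_iff span_neg[of "-a" S] by auto

lemma S_span: "s \<in> S \<Longrightarrow> s \<in> span S"
  by (rule span_base)

lemma cf_int: "a \<in> R \<Longrightarrow> s \<in> S \<Longrightarrow> cf a s \<in> \<int>"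
  using sgn[of a] R_span[of a] by (auto simp: nonneg_int_comb_iff cf_neg)

lemma P_iff: "a \<in> P \<longleftrightarrow> a \<in> R \<and> (\<forall>s\<in>S. 0 \<le> cf a s)"
  by (auto simp: pos_def nonneg_int_comb_iff R_span cf_int)

lemma PR: "a \<in> P \<Longrightarrow> a \<in> R"
  by (simp add: pos_def)

lemma P_span: "a \<in> P \<Longrightarrow> a \<in> span S"
  by (simp add: PR R_span)

lemmas spans = R_span P_span S_span span_add span_diff span_neg span_zero

lemma R_cases: "a \<in> R \<Longrightarrow> a \<in> P \<or> - a \<in> P"
  using sgn[of a] neg[of a] by (auto simp: pos_def)

lemma SP: "s \<in> S \<Longrightarrow> s \<in> P"
  using base by (auto simp: P_iff cf_base)

lemma vec_eqI: "u \<in> span S \<Longrightarrow> v \<in> span S \<Longrightarrow> (\<And>s. s \<in> S \<Longrightarrow> cf u s = cf v s) \<Longrightarrow> u = v"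
  using sum_cf[of u] sum_cf[of v] by (metis (no_types, lifting) sum.cong)

lemma P_coord:
  assumes "a \<in> P" obtains s where "s \<in> S" "cf a s \<ge> 1"
proof -
  have "a \<noteq> 0" using assms zero PR by auto
  then obtain s where s: "s \<in> S" "cf a s \<noteq> 0"
    using vec_eqI[of a 0] assms by (auto simp: spans real_vector.representation_zero)
  then have "cf a s > 0" using assms by (auto simp: P_iff less_le)
  moreover have "cf a s \<in> \<int>" using cf_int PR assms s by auto
  ultimately have "cf a s \<ge> 1" by (auto elim!: Ints_cases)
  then show ?thesis using s that by auto
qed

lemma P_if_coord:
  assumes "a \<in> R" "s \<in> S" "cf a s > 0" shows "a \<in> P"
  using R_cases[OF assms(1)] assms by (auto simp: P_iff cf_neg spans)

lemma P_notneg: "a \<in> P \<Longrightarrow> - a \<notin> P"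
proof
  assume a: "a \<in> P" "- a \<in> P"
  obtain s where "s \<in> S" "cf a s \<ge> 1" using P_coord a by blast
  then show False using a by (auto simp: P_iff cf_neg spans)
qed

lemma P_add_nz: "a \<in> P \<Longrightarrow> b \<in> P \<Longrightarrow> a + b \<noteq> 0"
  using P_notneg by (metis add_eq_0_iff)

lemma P_add: "a \<in> P \<Longrightarrow> b \<in> P \<Longrightarrow> a + b \<in> R \<Longrightarrow> a + b \<in> P"
  by (auto simp: P_iff cf_add spans)

lemma P_not0: "a \<in> P \<Longrightarrow> a \<noteq> 0"
  using PR zero by auto

lemma ht_add: "u \<in> span S \<Longrightarrow> v \<in> span S \<Longrightarrow> ht (u + v) = ht u + ht v"
  and ht_diff: "u \<in> span S \<Longrightarrow> v \<in> span S \<Longrightarrow> ht (u - v) = ht u - ht v"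
  by (simp_all add: ht_def cf_add cf_diff sum.distrib sum_subtractf)

lemma ht_base: "s \<in> S \<Longrightarrow> ht s = 1"
  by (simp add: ht_def cf_base finS)

lemma ht_mono_strict:
  assumes "u \<in> span S" "v \<in> span S" "le u v" "u \<noteq> v" shows "ht u < ht v"
proof -
  obtain s where "s \<in> S" "cf u s \<noteq> cf v s" using vec_eqI assms by blast
  then show ?thesis
    unfolding ht_def using assms(3) finS by (intro sum_strict_mono_ex1) (auto simp: le_def less_le)
qed

lemma ht_pos: assumes "a \<in> P" shows "ht a \<ge> 1"
proof -
  obtain s where s: "s \<in> S" "cf a s \<ge> 1" using P_coord assms by blast
  have "cf a s \<le> ht a"
    unfolding ht_def using assms s finS by (intro member_le_sum) (auto simp: P_iff)
  then show ?thesis using s by simp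
qed

lemma le_add: "a \<in> span S \<Longrightarrow> b \<in> P \<Longrightarrow> le a (a + b)"
  by (auto simp: le_def cf_add spans P_iff)

lemma le_trans: "le a b \<Longrightarrow> le b c \<Longrightarrow> le a c"
  unfolding le_def by force

lemma le_refl: "le a a"
  by (simp add: le_def)

lemma inner_cf: "v \<in> span S \<Longrightarrow> u \<bullet> v = (\<Sum>s\<in>S. cf v s * (u \<bullet> s))"
  using arg_cong[OF sum_cf[of v], of "\<lambda>w. u \<bullet> w"] by (simp add: inner_sum_right)

lemma span_sub_iff:
  assumes "K \<subseteq> S" "v \<in> span S"
  shows "v \<in> span K \<longleftrightarrow> (\<forall>s\<in>S - K. cf v s = 0)"
proof
  assume v: "v \<in> span K"
  have "representation S v = representation K v"
    by (rule real_vector.representation_extend) (use ind v assms in auto)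
  then show "\<forall>s\<in>S - K. cf v s = 0"
    using real_vector.representation_ne_zero[of K v] by auto
next
  assume z: "\<forall>s\<in>S - K. cf v s = 0"
  have "v = (\<Sum>s\<in>S. cf v s *\<^sub>R s)" using sum_cf assms by simp
  also have "\<dots> = (\<Sum>s\<in>K. cf v s *\<^sub>R s)"
    by (rule sum.mono_neutral_right) (use z assms finS in auto)
  finally show "v \<in> span K" by (metis (no_types, lifting) span_base span_scale span_sum)
qed

lemma add_R: "a \<in> R \<Longrightarrow> b \<in> R \<Longrightarrow> a \<bullet> b < 0 \<Longrightarrow> a + b \<noteq> 0 \<Longrightarrow> a + b \<in> R"
  using add by blast

lemma diff_R: "a \<in> R \<Longrightarrow> b \<in> R \<Longrightarrow> a \<bullet> b > 0 \<Longrightarrow> a \<noteq> b \<Longrightarrow> a - b \<in> R"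
  using add_R[of a "- b"] neg[of b] by simp

text \<open>The next two lemmas replace the Jacobi identity of the Lie algebra.\<close>

lemma jacobi1:
  assumes "a \<in> R" "b \<in> R" "c \<in> R" "b + c \<in> R" "a + b + c \<in> R"
  shows "a + b \<in> R \<union> {0} \<or> a + c \<in> R \<union> {0}"
proof (rule ccontr)
  assume no: "\<not> ?thesis"
  let ?g = "a + b + c"
  have 1: "a \<bullet> b \<ge> 0" "a \<bullet> c \<ge> 0" using no add assms by (meson not_less)+
  have 2: "?g \<bullet> b \<le> 0"
  proof (rule ccontr)
    assume "\<not> ?g \<bullet> b \<le> 0"
    then have "?g - b \<in> R \<union> {0}" using diff_R[of ?g b] assms by auto
    then show False using no by (simp add: algebra_simps)
  qed
  have 3: "?g \<bullet> c \<le> 0"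
  proof (rule ccontr)
    assume "\<not> ?g \<bullet> c \<le> 0"
    then have "?g - c \<in> R \<union> {0}" using diff_R[of ?g c] assms by auto
    then show False using no by (simp add: algebra_simps)
  qed
  \<comment> \<open>The failure of both alternatives has fixed the signs of all four products on the
    right, so the root \<open>b + c\<close> would have norm at most 0.\<close>
  have "(b + c) \<bullet> (b + c) = ?g \<bullet> b + ?g \<bullet> c - a \<bullet> b - a \<bullet> c"
    by (simp add: inner_add_left inner_add_right)
  then have "(b + c) \<bullet> (b + c) \<le> 0" using 1 2 3 by linarith
  then have "b + c = 0" by (metis inner_gt_zero_iff not_less)
  then show False using assms zero by auto
qed

lemma jacobi2:
  assumes "a \<in> R" "b \<in> R" "c \<in> R" "a + b \<in> R" "b + c \<in> R"
  shows "a + b + c \<in> R \<union> {0} \<or> a - c \<in> R \<union> {0}"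
proof (rule ccontr)
  assume no: "\<not> ?thesis"
  have 1: "(a + b) \<bullet> c \<ge> 0" using no add[of "a + b" c] assms by force
  have 2: "a \<bullet> (b + c) \<ge> 0"
    using no add[of a "b + c"] assms by (force simp: add.assoc)
  have 3: "a \<bullet> c \<le> 0" using no diff_R[of a c] assms by force
  have 4: "(a + b) \<bullet> (b + c) \<le> 0"
    using no diff_R[of "a + b" "b + c"] assms by (force simp: algebra_simps)
  \<comment> \<open>With the four signs just found, this identity makes the norm of the root
    \<open>b\<close> non-positive.\<close>
  have "(a + b) \<bullet> (b + c) = a \<bullet> (b + c) + b \<bullet> b + ((a + b) \<bullet> c - a \<bullet> c)"
    by (simp add: inner_add_left inner_add_right)
  then have "b \<bullet> b \<le> 0" using 1 2 3 4 by linarith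
  then have "b = 0" by (metis inner_gt_zero_iff not_less)
  then show False using assms(2) zero by auto
qed

section \<open>Moving between roots by simple roots\<close>

text \<open>Induction on the height of \<open>b\<close>. If some simple root in the support of
  \<open>b - a\<close> has negative product with \<open>a\<close>, it can be added to
  \<open>a\<close>. Otherwise \<open>a \<bullet> (b - a) \<ge> 0\<close>, hence
  \<open>b \<bullet> (b - a) > 0\<close>, so a simple root of that support can be subtracted from
  \<open>b\<close> without falling below \<open>a\<close>.\<close>

lemma up:
  assumes "a \<in> P" "b \<in> P" "le a b" "a \<noteq> b"
  shows "\<exists>s\<in>S. a + s \<in> P \<and> le (a + s) b"
proof -
  have *: "ht b \<le> real n \<Longrightarrow> ?thesis" for n
    using assms
  proof (induction n arbitrary: b)
    case 0
    then show ?case using ht_pos by force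
  next
    case (Suc n)
    let ?d = "b - a"
    have dS: "?d \<in> span S" using Suc.prems by (simp add: spans)
    have cfd: "cf ?d s = cf b s - cf a s" for s
      using Suc.prems by (simp add: cf_diff spans)
    have d1: "cf ?d s \<ge> 1" if "s \<in> S" "cf ?d s > 0" for s
    proof -
      have "cf ?d s \<in> \<int>" unfolding cfd using Suc.prems that by (intro Ints_diff cf_int PR)
      then show ?thesis using that by (auto elim!: Ints_cases)
    qed
    have d0: "cf ?d s \<ge> 0" if "s \<in> S" for s
      using Suc.prems that by (simp add: cfd le_def)
    show ?case
    proof (cases "\<exists>s\<in>S. cf ?d s > 0 \<and> a \<bullet> s < 0")
      case True
      then obtain s where s: "s \<in> S" "cf ?d s > 0" "a \<bullet> s < 0" by (elim bexE conjE)
      have "s \<in> P" using s SP by simp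
      then have "a + s \<in> P"
        using P_add[OF \<open>a \<in> P\<close>] add_R[OF PR PR s(3)] P_add_nz \<open>a \<in> P\<close> by simp
      moreover have "le (a + s) b"
        using Suc.prems s d1[of s] by (auto simp: le_def cf_add spans cf_base cfd)
      ultimately show ?thesis using s by blast
    next
      case False
      then have "a \<bullet> ?d \<ge> 0"
        unfolding inner_cf[OF dS]
      proof (intro sum_nonneg)
        fix s assume s: "s \<in> S"
        then show "0 \<le> cf ?d s * (a \<bullet> s)"
          using False d0[OF s] by (cases "cf ?d s = 0") (auto simp: less_le intro!: mult_nonneg_nonneg)
      qed
      moreover have "?d \<bullet> ?d > 0" using Suc.prems by simp
      moreover have "b \<bullet> ?d = a \<bullet> ?d + ?d \<bullet> ?d" by (simp add: inner_diff_left)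
      ultimately have "b \<bullet> ?d > 0" by linarith
      then obtain s where s: "s \<in> S" "cf ?d s * (b \<bullet> s) > 0"
        unfolding inner_cf[OF dS] by (meson not_less sum_nonpos)
      then have s': "cf ?d s \<ge> 1" "b \<bullet> s > 0"
        using d0[of s] d1[of s] by (auto simp: zero_less_mult_iff)
      have lea: "le a (b - s)"
        using Suc.prems s' s d0 by (auto simp: le_def cf_diff spans cf_base cfd)
      have "b - s \<noteq> 0"
      proof
        assume "b - s = 0"
        then have n: "\<forall>t\<in>S. cf a t \<le> 0"
          using lea unfolding le_def by (simp add: real_vector.representation_zero)
        obtain t where "t \<in> S" "cf a t \<ge> 1" using P_coord[OF \<open>a \<in> P\<close>] .
        then show False using n by force
      qed
      then have "b - s \<in> R"
        using diff_R[OF PR[OF \<open>b \<in> P\<close>] PR[OF SP[OF s(1)]] s'(2)] by auto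
      then have bs: "b - s \<in> P"
        using lea \<open>a \<in> P\<close> unfolding P_iff le_def by (meson order_trans)
      show ?thesis
      proof (cases "b - s = a")
        case True
        then have "a + s = b" by auto
        then show ?thesis using s Suc.prems le_refl by auto
      next
        case False
        have "ht (b - s) \<le> real n" using Suc.prems s by (simp add: ht_diff spans ht_base)
        then have "\<exists>t\<in>S. a + t \<in> P \<and> le (a + t) (b - s)"
          using Suc.IH[of "b - s"] bs lea False Suc.prems by auto
        moreover have "le (b - s) b"
          using le_add[of "b - s" s] s SP bs by (simp add: spans)
        ultimately show ?thesis using le_trans by blast
      qed
    qed
  qed
  obtain n where "ht b \<le> real n" using real_arch_simple by blast
  then show ?thesis by (rule *)
qed

text \<open>Expanding \<open>b \<bullet> b > 0\<close> in simple roots shows that one in the support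
  of \<open>b\<close> has positive product with \<open>b\<close>; it can be subtracted.\<close>

lemma down:
  assumes "b \<in> P" "b \<notin> S"
  shows "\<exists>s\<in>S. b - s \<in> P"
proof -
  have "b \<bullet> b > 0" using assms P_not0 by auto
  then obtain s where s: "s \<in> S" "cf b s * (b \<bullet> s) > 0"
    unfolding inner_cf[OF P_span[OF assms(1)], of b] by (meson not_less sum_nonpos)
  then have s': "cf b s > 0" "b \<bullet> s > 0"
    using assms by (auto simp: zero_less_mult_iff P_iff not_less)
  have bs: "b - s \<in> R" using diff_R[of b s] s s' SP PR assms by auto
  have "cf b s \<in> \<int>" using assms s by (simp add: cf_int PR)
  then have "cf b s \<ge> 1" using s' by (auto elim!: Ints_cases)
  then have "b - s \<in> P"
    using bs assms s by (auto simp: P_iff cf_diff spans cf_base)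
  then show ?thesis using s by blast
qed

text \<open>A positive root outside \<open>span K\<close> has a positive coordinate outside
  \<open>K\<close>. Translation by \<open>span K\<close> preserves that coordinate, and a single
  positive coordinate determines the sign of a root.\<close>

lemma fibre_closed:
  assumes "K \<subseteq> S" "a \<in> P" "a \<notin> span K" "b \<in> R" "b - a \<in> span K"
  shows "b \<in> P" "b \<notin> span K"
proof -
  obtain s where s: "s \<in> S - K" "cf a s \<noteq> 0" using assms span_sub_iff[of K a] spans by auto
  have "cf (b - a) s = 0" using span_sub_iff[of K "b - a"] assms s by (auto simp: spans)
  then have e: "cf b s = cf a s" using assms by (simp add: cf_diff spans)
  then have "cf b s > 0" using assms s by (auto simp: P_iff less_le)
  then show "b \<in> P" using P_if_coord assms s by auto
  show "b \<notin> span K" using span_sub_iff[of K b] assms s e spans by auto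
qed

text \<open>The l1 norm in simple coordinates, used as the induction measure for paths inside a
  fibre.\<close>

definition dst where "dst v = (\<Sum>s\<in>S. \<bar>cf v s\<bar>)"

text \<open>Positivity of the product yields a simple root \<open>s\<close> for which
  \<open>a \<bullet> s\<close> and the coordinate of \<open>a - b\<close> have the same sign; it
  lies in \<open>K\<close> because \<open>a - b\<close> is in \<open>span K\<close>. Subtracting or
  adding \<open>s\<close>, according to this sign, moves \<open>a\<close> towards
  \<open>b\<close>.\<close>

lemma fibre_step:
  assumes K: "K \<subseteq> S" and a: "a \<in> P" "a \<notin> span K" and b: "b \<in> P" and ab: "a - b \<in> span K"
    and pos: "a \<bullet> (a - b) > 0"
    and Q: "\<And>c s. c \<in> P \<Longrightarrow> c \<notin> span K \<Longrightarrow> s \<in> K \<Longrightarrow> c + s \<in> R \<Longrightarrow> Q c \<longleftrightarrow> Q (c + s)"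
  shows "\<exists>a'\<in>P. a' \<notin> span K \<and> a' - b \<in> span K \<and> (Q a' \<longleftrightarrow> Q a) \<and> dst (a' - b) \<le> dst (a - b) - 1"
proof -
  let ?d = "a - b"
  have dS: "?d \<in> span S" using a b by (simp add: spans)
  obtain s where s: "s \<in> S" "cf ?d s * (a \<bullet> s) > 0"
    using pos unfolding inner_cf[OF dS] by (meson not_less sum_nonpos)
  then have sK: "s \<in> K" using span_sub_iff[OF K dS] ab by (cases "s \<in> K") auto
  have dZ: "cf ?d s \<in> \<int>" using a b s by (simp add: cf_diff spans Ints_diff cf_int PR)
  have dst_less: "dst (?d + v) \<le> dst ?d - 1"
    if "v \<in> span S" "\<bar>cf ?d s + cf v s\<bar> \<le> \<bar>cf ?d s\<bar> - 1" "\<And>t. t \<in> S \<Longrightarrow> t \<noteq> s \<Longrightarrow> cf v t = 0" for v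
  proof -
    have "(\<Sum>t\<in>S - {s}. \<bar>cf (?d + v) t\<bar>) = (\<Sum>t\<in>S - {s}. \<bar>cf ?d t\<bar>)"
      using that dS by (intro sum.cong) (auto simp: cf_add)
    then show ?thesis
      using that dS by (simp add: dst_def sum.remove[OF finS s(1)] cf_add)
  qed
  have sP: "s \<in> R" using s SP PR by auto
  from s consider "cf ?d s > 0" "a \<bullet> s > 0" | "cf ?d s < 0" "a \<bullet> s < 0"
    by (auto simp: zero_less_mult_iff)
  then show ?thesis
  proof cases
    case 1
    have ne: "a \<noteq> s" using a sK span_base by auto
    have r: "a - s \<in> R" using diff_R[OF PR[OF a(1)] sP] 1 ne by auto
    have a': "a - s \<in> P" "a - s \<notin> span K"
      using fibre_closed[OF K a r] sK by (auto simp: span_base span_neg)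
    have "cf ?d s \<ge> 1" using 1 dZ by (auto elim!: Ints_cases)
    then have "dst (?d + (- s)) \<le> dst ?d - 1"
      using s by (intro dst_less) (auto simp: spans cf_neg cf_base)
    moreover have "a - s - b \<in> span K"
      using span_diff[OF ab span_base[OF sK]] by (simp add: algebra_simps)
    moreover have "Q (a - s) \<longleftrightarrow> Q a" using Q[OF a' sK] a PR by auto
    ultimately show ?thesis
      using a' by (intro bexI[of _ "a - s"]) (auto simp: algebra_simps)
  next
    case 2
    have r: "a + s \<in> R" using add_R[OF PR[OF a(1)] sP] 2 P_add_nz a s SP by auto
    have a': "a + s \<in> P" "a + s \<notin> span K"
      using fibre_closed[OF K a r] sK by (auto simp: span_base)
    have "cf ?d s \<le> -1" using 2 dZ by (auto elim!: Ints_cases)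
    then have "dst (?d + s) \<le> dst ?d - 1"
      using s by (intro dst_less) (auto simp: spans cf_base)
    moreover have "a + s - b \<in> span K"
      using span_add[OF ab span_base[OF sK]] by (simp add: algebra_simps)
    moreover have "Q (a + s) \<longleftrightarrow> Q a" using Q[OF a sK r] by auto
    ultimately show ?thesis
      using a' by (intro bexI[of _ "a + s"]) (auto simp: algebra_simps)
  qed
qed

text \<open>The fibres of \<open>\<pi>\<^sub>K\<close> over non-zero elements are connected by steps along simple roots
  of \<open>K\<close>: two distinct elements can always be moved closer, as
  \<open>a \<bullet> (a - b) - b \<bullet> (a - b) > 0\<close>.\<close>

lemma fibre_connected:
  assumes K: "K \<subseteq> S" and a: "a \<in> P" "a \<notin> span K" and b: "b \<in> P" and ab: "a - b \<in> span K"
    and Q: "\<And>c s. c \<in> P \<Longrightarrow> c \<notin> span K \<Longrightarrow> s \<in> K \<Longrightarrow> c + s \<in> R \<Longrightarrow> Q c \<longleftrightarrow> Q (c + s)"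
  shows "Q a \<longleftrightarrow> Q b"
proof -
  have dst0: "dst v \<ge> 0" for v by (simp add: dst_def sum_nonneg)
  have dst_sym: "dst (x - y) = dst (y - x)" if "x \<in> P" "y \<in> P" for x y
    using that by (simp add: dst_def cf_diff spans abs_minus_commute)
  have *: "dst (a - b) \<le> real n \<Longrightarrow> Q a \<longleftrightarrow> Q b" for n
    using a b ab
  proof (induction n arbitrary: a b)
    case (0 a b)
    show ?case
    proof (rule ccontr)
      assume "\<not> ?case"
      then have "a \<noteq> b" by auto
      then obtain s where "s \<in> S" "cf (a - b) s \<noteq> 0"
        using vec_eqI[of "a - b" 0] 0 by (auto simp: spans real_vector.representation_zero)
      then have "dst (a - b) > 0"
        unfolding dst_def using finS by (intro sum_pos2[of S s]) auto
      then show False using 0 by simp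
    qed
  next
    case (Suc n a b)
    have ba: "b - a \<in> span K" using Suc.prems span_neg[of "a - b" K] by simp
    have b': "b \<notin> span K" using fibre_closed[OF K, of a b] Suc.prems ba PR by blast
    show ?case
    proof (cases "a = b")
      case False
      then have "(a - b) \<bullet> (a - b) > 0" by simp
      then consider "a \<bullet> (a - b) > 0" | "b \<bullet> (b - a) > 0"
        by (smt (verit) inner_diff_left inner_minus_right minus_diff_eq)
      then show ?thesis
      proof cases
        case 1
        obtain a' where "a' \<in> P" "a' \<notin> span K" "a' - b \<in> span K" "Q a' \<longleftrightarrow> Q a"
          "dst (a' - b) \<le> dst (a - b) - 1"
          using fibre_step[OF K Suc.prems(2,3,4,5) 1 Q] by blast
        then show ?thesis using Suc.IH[of a' b] Suc.prems by auto
      next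
        case 2
        obtain b1 where b1: "b1 \<in> P" "b1 \<notin> span K" "b1 - a \<in> span K" "Q b1 \<longleftrightarrow> Q b"
          "dst (b1 - a) \<le> dst (b - a) - 1"
          using fibre_step[OF K Suc.prems(4) b' Suc.prems(2) ba 2 Q] by blast
        then have "a - b1 \<in> span K" using span_neg[of "b1 - a" K] by simp
        then show ?thesis
          using Suc.IH[of a b1] Suc.prems b1 dst_sym[of a b1] dst_sym[of a b] by auto
      qed
    qed simp
  qed
  obtain n where "dst (a - b) \<le> real n" using real_arch_simple by blast
  then show ?thesis by (rule *)
qed

section \<open>Supports of inversion sets\<close>

text \<open>\<open>G\<close> is the positive part of a symmetric closed subset. If a simple root in the support of
  \<open>\<gamma>\<close> were missing from \<open>G\<close>, then \<open>\<gamma>\<close> would be a sum of two positive roots outside \<open>G\<close>,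
  contradicting the co-closedness of \<open>\<Phi>\<close>.\<close>

lemma supp_closed:
  assumes GP: "G \<subseteq> P"
    and G1: "\<And>a b. a \<in> G \<Longrightarrow> b \<in> G \<Longrightarrow> a + b \<in> R \<Longrightarrow> a + b \<in> G"
    and G2: "\<And>a b. a \<in> G \<Longrightarrow> b \<in> P \<Longrightarrow> a + b \<in> G \<Longrightarrow> b \<in> G"
    and \<Phi>: "\<Phi> \<subseteq> G" "\<And>a b. a \<in> P - \<Phi> \<Longrightarrow> b \<in> P - \<Phi> \<Longrightarrow> a + b \<notin> \<Phi>"
    and g: "\<gamma> \<in> \<Phi>" and s: "s \<in> S" "cf \<gamma> s \<noteq> 0"
  shows "s \<in> G"
proof -
  \<comment> \<open>\<open>D\<close> collects the elements of \<open>G\<close> that split into two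
    positive roots outside \<open>G\<close>. Since \<open>\<Phi> \<subseteq> G\<close> is co-closed,
    \<gamma> cannot belong to it.\<close>
  define D where "D = {y \<in> G. \<exists>y1\<in>P - G. \<exists>y2\<in>P - G. y = y1 + y2}"
  \<comment> \<open>By \<open>jacobi1\<close> the new summand \<open>z\<close> can be absorbed into
    \<open>y1\<close> or \<open>y2\<close>, and by \<open>G2\<close> the enlarged summand stays
    outside \<open>G\<close>.\<close>
  have D_add: "y + z \<in> D" if y: "y \<in> D" and z: "z \<in> G" and yz: "y + z \<in> R" for y z
  proof -
    obtain y1 y2 where y12: "y1 \<in> P - G" "y2 \<in> P - G" "y = y1 + y2" "y \<in> G"
      using y by (auto simp: D_def)
    have yzG: "y + z \<in> G" using G1 y12 z yz by blast
    have P: "z \<in> P" "y1 \<in> P" "y2 \<in> P" using z y12 GP by auto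
    have "z + y1 + y2 \<in> R" "y1 + y2 \<in> R" using yz y12 GP PR by (auto simp: algebra_simps)
    then have "z + y1 \<in> R \<union> {0} \<or> z + y2 \<in> R \<union> {0}"
      using jacobi1 P PR by blast
    then consider "z + y1 \<in> P" | "z + y2 \<in> P"
      using P_add P_add_nz P by blast
    then show ?thesis
    proof cases
      case 1
      then have "z + y1 \<in> P - G" using G2 z y12 by blast
      moreover have "y + z = (z + y1) + y2" using y12 by (simp add: algebra_simps)
      ultimately show ?thesis using yzG y12 unfolding D_def by blast
    next
      case 2
      then have "z + y2 \<in> P - G" using G2 z y12 by blast
      moreover have "y + z = y1 + (z + y2)" using y12 by (simp add: algebra_simps)
      ultimately show ?thesis using yzG y12 unfolding D_def by blast
    qed
  qed
  \<comment> \<open>A splitting of \<open>y\<close> inside \<open>G\<close> is handled by induction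
    and \<open>D_add\<close>. Without one, a simple root \<open>s\<close> is split off from a
    non-simple \<open>y\<close>: if \<open>s\<close> or \<open>y - s\<close> were in
    \<open>G\<close>, then by \<open>G2\<close> both would be, so the splitting witnesses
    \<open>y \<in> D\<close>.\<close>
  have *: "ht y \<le> real n \<Longrightarrow> y \<in> G \<Longrightarrow> y \<in> D \<or> (\<forall>s\<in>S. cf y s \<noteq> 0 \<longrightarrow> s \<in> G)" for n y
  proof (induction n arbitrary: y)
    case 0
    then show ?case using ht_pos[of y] GP by auto
  next
    case (Suc n)
    show ?case
    proof (cases "\<exists>y1\<in>G. \<exists>y2\<in>G. y = y1 + y2")
      case True
      then obtain y1 y2 where y: "y1 \<in> G" "y2 \<in> G" "y = y1 + y2" by blast
      have P: "y1 \<in> P" "y2 \<in> P" using y GP by auto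
      have "ht y = ht y1 + ht y2" unfolding y(3) using P by (simp add: ht_add spans)
      then have "ht y1 \<le> real n" "ht y2 \<le> real n"
        using Suc.prems ht_pos[OF P(1)] ht_pos[OF P(2)] by auto
      then have 1: "y1 \<in> D \<or> (\<forall>s\<in>S. cf y1 s \<noteq> 0 \<longrightarrow> s \<in> G)"
        and 2: "y2 \<in> D \<or> (\<forall>s\<in>S. cf y2 s \<noteq> 0 \<longrightarrow> s \<in> G)"
        using Suc.IH y by auto
      have yR: "y1 + y2 \<in> R" "y2 + y1 \<in> R"
        using Suc.prems y GP PR by (auto simp: add.commute)
      have "cf y s = cf y1 s + cf y2 s" for s unfolding y(3) using P by (simp add: cf_add spans)
      then show ?thesis
        using 1 2 D_add[OF _ y(2) yR(1)] D_add[OF _ y(1) yR(2)] y(3) by (force simp: add.commute)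
    next
      case False
      show ?thesis
      proof (cases "y \<in> S")
        case True
        then show ?thesis using Suc.prems by (auto simp: cf_base)
      next
        case ns: False
        then obtain s where s: "s \<in> S" "y - s \<in> P" using down[of y] Suc.prems GP by blast
        have e: "s + (y - s) = y" "(y - s) + s = y" by auto
        have "s \<notin> G"
          using G2[of s "y - s"] s Suc.prems False e by (metis)
        moreover have "y - s \<notin> G"
          using G2[of "y - s" s] s SP Suc.prems False e by (metis)
        ultimately have "y \<in> D"
          using s SP Suc.prems e(1) unfolding D_def by (metis (mono_tags, lifting) DiffI mem_Collect_eq)
        then show ?thesis ..
      qed
    qed
  qed
  obtain n where "ht \<gamma> \<le> real n" using real_arch_simple by blast
  moreover have "\<gamma> \<notin> D" using \<Phi> g unfolding D_def by blast
  ultimately show ?thesis using * g \<Phi> s by blast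
qed

section \<open>Partitions of the positive roots into three inversion sets\<close>

definition tripartition where
  "tripartition A B C \<longleftrightarrow> A \<union> B \<union> C = P \<and> A \<inter> B = {} \<and> A \<inter> C = {} \<and> B \<inter> C = {} \<and>
     inversion_set R S A \<and> inversion_set R S B \<and> inversion_set R S C"

lemma inversion_setD:
  assumes "inversion_set R S X"
  shows "X \<subseteq> P" "a \<in> X \<Longrightarrow> b \<in> X \<Longrightarrow> a + b \<in> R \<Longrightarrow> a + b \<in> X"
    "a \<in> P - X \<Longrightarrow> b \<in> P - X \<Longrightarrow> a + b \<notin> X"
  using assms PR by (auto simp: inversion_set_def closed_rs_def)

lemma tripartition_swap: "tripartition A B C \<Longrightarrow> tripartition A C B"
  by (auto simp: tripartition_def)

lemma tripartition_swap13: "tripartition A B C \<Longrightarrow> tripartition C B A"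
  by (auto simp: tripartition_def)

lemma tripartitionD:
  assumes "tripartition A B C"
  shows "A \<subseteq> P" "B \<subseteq> P" "C \<subseteq> P" "a \<in> P \<Longrightarrow> a \<in> A \<or> a \<in> B \<or> a \<in> C"
    "a \<in> A \<Longrightarrow> a \<notin> B" "a \<in> A \<Longrightarrow> a \<notin> C" "a \<in> B \<Longrightarrow> a \<notin> C"
  using assms by (auto simp: tripartition_def)

text \<open>The absence of rainbow triangles: both summands lie outside \<open>C\<close>, which is
  co-closed.\<close>

lemma tripartition_add:
  assumes t: "tripartition A B C" and a: "a \<in> A" and b: "b \<in> B" and ab: "a + b \<in> C" shows False
proof -
  have "inversion_set R S C" using t by (simp add: tripartition_def)
  then show False using inversion_setD(3)[of C a b] a b ab tripartitionD[OF t] by blast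
qed

text \<open>Second stage of the proof. \<open>supp_closed\<close> is applied to the set
  \<open>G\<close> of positive roots in \<open>span K\<close> whose addition preserves membership in
  \<open>A\<close> outside \<open>span K\<close>.\<close>

lemma supp_invariant:
  assumes t: "tripartition A B C" and KS: "K \<subseteq> S" and CK: "C \<subseteq> span K"
    and s: "s \<in> S" "x \<in> C" "cf x s \<noteq> 0"
    and a: "a \<in> P" "a \<notin> span K" "a + s \<in> R"
  shows "a \<in> A \<longleftrightarrow> a + s \<in> A"
proof -
  have fib: "a + k \<in> P" "a + k \<notin> span K"
    if "a \<in> P" "a \<notin> span K" "k \<in> span K" "a + k \<in> R" for a k
    using fibre_closed[OF KS, of a "a + k"] that by auto
  have fib': "a - k \<in> P" "a - k \<notin> span K"
    if "a \<in> P" "a \<notin> span K" "k \<in> span K" "a - k \<in> R" for a k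
    using fibre_closed[OF KS, of a "a - k"] that by (auto simp: span_neg)
  define G where "G = {k \<in> P. k \<in> span K \<and>
    (\<forall>a\<in>P. a \<notin> span K \<longrightarrow> a + k \<in> R \<longrightarrow> (a \<in> A \<longleftrightarrow> a + k \<in> A))}"
  have GP: "G \<subseteq> P" by (auto simp: G_def)
  have GD: "a \<in> A \<longleftrightarrow> a + k \<in> A" if "k \<in> G" "a \<in> P" "a \<notin> span K" "a + k \<in> R" for a k
    using that by (auto simp: G_def)
  have "s \<in> G"
  proof (rule supp_closed[OF GP])
    fix k1 k2 assume k: "k1 \<in> G" "k2 \<in> G" "k1 + k2 \<in> R"
    have kP: "k1 \<in> P" "k2 \<in> P" "k1 \<in> span K" "k2 \<in> span K" using k by (auto simp: G_def)
    have "a \<in> A \<longleftrightarrow> a + (k1 + k2) \<in> A"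
      if a: "a \<in> P" "a \<notin> span K" "a + (k1 + k2) \<in> R" for a
    proof -
      \<comment> \<open>One of \<open>k1\<close>, \<open>k2\<close> can be added first, so that the
        passage to \<open>a + (k1 + k2)\<close> consists of two steps along
        \<open>G\<close>.\<close>
      have "a + k1 \<in> R \<union> {0} \<or> a + k2 \<in> R \<union> {0}"
        using jacobi1[of a k1 k2] a k kP PR by (simp add: add.assoc)
      then consider "a + k1 \<in> R" | "a + k2 \<in> R" using P_add_nz a kP by blast
      then show ?thesis
      proof cases
        case 1
        have "a \<in> A \<longleftrightarrow> a + k1 \<in> A" using GD k a 1 by blast
        also have "\<dots> \<longleftrightarrow> a + k1 + k2 \<in> A"
          using GD[OF k(2) fib[OF a(1,2) kP(3) 1]] a by (simp add: add.assoc)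
        finally show ?thesis by (simp add: add.assoc)
      next
        case 2
        have e: "a + (k1 + k2) = a + k2 + k1" by (simp add: algebra_simps)
        have "a \<in> A \<longleftrightarrow> a + k2 \<in> A" using GD k a 2 by blast
        also have "\<dots> \<longleftrightarrow> a + k2 + k1 \<in> A"
          using GD[OF k(1) fib[OF a(1,2) kP(4) 2]] a unfolding e by simp
        finally show ?thesis unfolding e .
      qed
    qed
    then show "k1 + k2 \<in> G" using P_add k kP by (auto simp: G_def span_add)
  next
    fix k1 k2 assume k: "k1 \<in> G" "k2 \<in> P" "k1 + k2 \<in> G"
    have kP: "k1 \<in> P" "k1 + k2 \<in> P" "k1 \<in> span K" "k1 + k2 \<in> span K" using k by (auto simp: G_def)
    have k2: "k2 \<in> span K" using span_diff[OF kP(4,3)] by simp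
    have "a \<in> A \<longleftrightarrow> a + k2 \<in> A"
      if a: "a \<in> P" "a \<notin> span K" "a + k2 \<in> R" for a
    proof -
      have e: "a + k2 + k1 = a + (k1 + k2)" by (simp add: algebra_simps)
      \<comment> \<open>Either \<open>a\<close> and \<open>a + k2\<close> are both compared with
        \<open>a + k2 + k1\<close>, or both are compared with \<open>a - k1\<close>.\<close>
      have "a + k2 + k1 \<in> R \<union> {0} \<or> a - k1 \<in> R \<union> {0}"
        using jacobi2[of a k2 k1] a k kP PR by (simp add: add.commute)
      moreover have "a + k2 + k1 \<noteq> 0" unfolding e using P_add_nz a kP by blast
      moreover have "a - k1 \<noteq> 0" using a kP by auto
      ultimately consider "a + k2 + k1 \<in> R" | "a - k1 \<in> R" by blast
      then show ?thesis
      proof cases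
        case 1
        have "a + k2 \<in> A \<longleftrightarrow> a + k2 + k1 \<in> A"
          using GD[OF k(1) fib[OF a(1,2) k2 a(3)]] 1 by blast
        moreover have "a \<in> A \<longleftrightarrow> a + (k1 + k2) \<in> A"
          using GD[OF k(3) a(1,2)] 1 unfolding e by blast
        ultimately show ?thesis unfolding e by blast
      next
        case 2
        note f = fib'[OF a(1,2) kP(3) 2]
        have "a - k1 \<in> A \<longleftrightarrow> a \<in> A" using GD[OF k(1) f] a PR by simp
        moreover have "a - k1 \<in> A \<longleftrightarrow> a + k2 \<in> A"
          using GD[OF k(3) f] a by (simp add: algebra_simps)
        ultimately show ?thesis by blast
      qed
    qed
    then show "k2 \<in> G" using k k2 by (auto simp: G_def)
  next
    \<comment> \<open>Outside \<open>span K\<close> only \<open>A\<close> and \<open>B\<close>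
      occur. A change between them on adding an element of \<open>C\<close> would be a rainbow
      triangle.\<close>
    have "a \<in> A \<longleftrightarrow> a + k \<in> A" if "k \<in> C" "a \<in> P" "a \<notin> span K" "a + k \<in> R" for a k
    proof -
      have kP: "k \<in> P" "k \<in> span K" using that tripartitionD[OF t] CK by auto
      have f: "a + k \<in> P" "a + k \<notin> span K" using fib that kP by auto
      have "a \<notin> C" "a + k \<notin> C" using that f CK by auto
      moreover note tripartitionD(4)[OF t that(2)] tripartitionD(4)[OF t f(1)]
      ultimately consider "a \<in> A" "a + k \<in> B" | "a \<in> B" "a + k \<in> A"
        | "a \<in> A" "a + k \<in> A" | "a \<in> B" "a + k \<in> B" by blast
      then show ?thesis
      proof cases
        case 1
        have "tripartition A C B" by (rule tripartition_swap[OF t])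
        then show ?thesis using tripartition_add 1 that by blast
      next
        case 2
        have "tripartition B C A" using tripartition_swap tripartition_swap13 t by blast
        then show ?thesis using tripartition_add 2 that by blast
      qed (use tripartitionD[OF t] in blast)+
    qed
    then show "C \<subseteq> G" using tripartitionD(3)[OF t] CK unfolding G_def by blast
  next
    show "a + b \<notin> C" if "a \<in> P - C" "b \<in> P - C" for a b
      using inversion_setD(3)[of C] t that by (auto simp: tripartition_def)
  qed (use s in auto)
  then show ?thesis using GD a by blast
qed

text \<open>Let \<open>m \<in> C\<close> be minimal with \<open>s\<close> in its support. Minimality lets us descend from \<open>m\<close> to
  \<open>s\<close> by subtracting elements of \<open>C\<close> only. Along this path we transport a decomposition
  \<open>\<beta> + y\<close> of a root above the maximal root \<open>\<alpha>\<close>, with \<open>\<beta> \<in> B\<close>, from \<open>y = s\<close> to \<open>y = m\<close>,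
  where it contradicts \<open>\<beta> + m \<in> A\<close>.\<close>

lemma supp_not_full_aux:
  assumes t: "tripartition A B C" and al: "\<alpha> \<in> B" and max: "\<And>x. x \<in> B \<union> C \<Longrightarrow> ht x \<le> ht \<alpha>"
    and s: "s \<in> S" "\<alpha> + s \<in> P" and x: "x \<in> C"
  shows "cf x s = 0"
proof (rule ccontr)
  assume xs: "cf x s \<noteq> 0"
  note sub = tripartitionD(1-3)[OF t]
  have tBCA: "tripartition B C A" using t tripartition_swap tripartition_swap13 by blast
  \<comment> \<open>A root strictly above \<alpha> exceeds the maximal height attained in
    \<open>B \<union> C\<close>.\<close>
  have above: "y \<in> A" if "y \<in> P" "le \<alpha> y" "y \<noteq> \<alpha>" for y
  proof -
    have "ht \<alpha> < ht y" using that al sub by (intro ht_mono_strict) (auto simp: spans)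
    then show ?thesis using max[of y] tripartitionD(4)[OF t that(1)] by force
  qed
  have aboves: "y \<in> A" if "y \<in> P" "le (\<alpha> + s) y" for y
  proof (rule above[OF that(1)])
    have aP: "\<alpha> \<in> P" using al sub by auto
    show "le \<alpha> y" using le_trans[OF le_add[of \<alpha> s] that(2)] aP s SP by (simp add: spans)
    have "cf (\<alpha> + s) s \<le> cf y s" using that s by (simp add: le_def)
    then show "y \<noteq> \<alpha>" using s aP by (auto simp: cf_add spans cf_base)
  qed
  let ?M = "{x \<in> C. cf x s \<noteq> 0}"
  have "finite ?M" using fin sub PR by (auto intro!: finite_subset[of _ R])
  moreover have "?M \<noteq> {}" using x xs by auto
  ultimately obtain m where m: "is_arg_min ht (\<lambda>x. x \<in> ?M) m"
    using ex_is_arg_min_if_finite by blast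
  then have mC: "m \<in> C" "cf m s \<noteq> 0" and mmin: "\<And>y. y \<in> C \<Longrightarrow> cf y s \<noteq> 0 \<Longrightarrow> \<not> ht y < ht m"
    by (auto simp: is_arg_min_def)
  have mP: "m \<in> P" using mC sub by auto
  define Y where "Y = rtranclp (\<lambda>y z. z \<in> P \<and> cf z s \<noteq> 0 \<and> y - z \<in> C) m"
  have Y_step: "Y z" if "Y y" "z \<in> P" "cf z s \<noteq> 0" "y - z \<in> C" for y z
    using that unfolding Y_def by (simp add: rtranclp.rtrancl_into_rtrancl)
  have YP: "y \<in> P \<and> le y m" if "Y y" for y
    using that unfolding Y_def
  proof (induction rule: rtranclp_induct)
    case base
    then show ?case using mP le_refl by simp
  next
    case (step y z)
    then have "y - z \<in> P" using sub by auto
    then have "le z (z + (y - z))" using step by (intro le_add) (auto simp: spans)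
    then show ?case using step le_trans[of z y m] by simp
  qed
  \<comment> \<open>Subtracting any positive root amounts to steps by elements of \<open>C\<close>,
    as long as \<open>s\<close> stays in the support. At \<open>m\<close>, minimality gives
    \<open>z \<notin> C\<close>, and co-closedness puts \<open>m - z\<close> into \<open>C\<close>.
    After a step by \<open>?k\<close>, \<open>jacobi1\<close> allows either subtracting
    \<open>?l\<close> before \<open>?k\<close> or subtracting \<open>?l + ?k\<close> at
    once.\<close>
  have Y_any: "Y z" if "Y y" "z \<in> P" "cf z s \<noteq> 0" "y - z \<in> P" for y z
    using that(1) that(2-4) unfolding Y_def
  proof (induction arbitrary: z rule: rtranclp_induct)
    case (base z)
    have "ht m = ht z + ht (m - z)" using mP base by (simp add: ht_diff spans)
    then have "z \<notin> C" using mmin[of z] base ht_pos[of "m - z"] by force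
    have "m - z \<in> C"
    proof (rule ccontr)
      assume "m - z \<notin> C"
      then have "z + (m - z) \<notin> C"
        using inversion_setD(3)[of C z "m - z"] t base \<open>z \<notin> C\<close> by (auto simp: tripartition_def)
      then show False using mC by simp
    qed
    then show ?case using base by auto
  next
    case (step y w z)
    have Yy: "Y y" using step by (simp add: Y_def)
    let ?k = "y - w" and ?l = "w - z"
    have kP: "?k \<in> P" using step sub by auto
    have yP: "y \<in> P" using YP Yy by blast
    have "- ?l \<in> R" "- ?k \<in> R" using neg PR step.prems(3) kP by blast+
    moreover have "y + - ?k = w" "- ?l + y + - ?k = z" by simp_all
    ultimately have "- ?l + y \<in> R \<union> {0} \<or> - ?l + - ?k \<in> R \<union> {0}"
      using jacobi1[of "- ?l" y "- ?k"] yP PR step by metis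
    moreover have "- ?l + - ?k \<noteq> 0" using P_add_nz[OF step.prems(3) kP] by (simp add: algebra_simps)
    moreover have e: "- ?l + y = z + ?k" by simp
    moreover have "z + ?k \<noteq> 0" using P_add_nz step.prems kP by blast
    ultimately consider "z + ?k \<in> R" | "- ?l + - ?k \<in> R" unfolding e by blast
    then have "Y z"
    proof cases
      case 1
      then have zk: "z + ?k \<in> P" using P_add step.prems kP by blast
      have "cf (z + ?k) s \<noteq> 0"
        using step.prems kP s by (simp add: cf_add spans P_iff) (smt (verit))
      then have "Y (z + ?k)" using step.IH[of "z + ?k"] zk step.prems by (simp add: Y_def)
      then show ?thesis using Y_step[of "z + ?k" z] step by simp
    next
      case 2
      then have "?l + ?k \<in> R" using neg[of "- ?l + - ?k"] by (simp add: algebra_simps)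
      then have "?l + ?k \<in> P" using P_add step.prems kP by blast
      then have "y - z \<in> P" by simp
      then show ?thesis using step.IH[of z] step.prems by (simp add: Y_def)
    qed
    then show ?case by (simp add: Y_def)
  qed
  have cf_le: "cf a s \<noteq> 0" if "le s a" "a \<in> P" for a
    using that s unfolding le_def by (auto simp: cf_base)
  \<comment> \<open>The chain of simple steps from \<open>a\<close> up to \<open>m\<close> given by
    \<open>up\<close> is reversed with \<open>Y_any\<close>.\<close>
  have reach: "ht m - ht a \<le> real n \<Longrightarrow> a \<in> P \<Longrightarrow> le s a \<Longrightarrow> le a m \<Longrightarrow> Y a" for n a
  proof (induction n arbitrary: a)
    case (0 a)
    have "a = m" using ht_mono_strict[of a m] 0 mP by (force simp: spans)
    then show ?case by (simp add: Y_def)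
  next
    case (Suc n a)
    show ?case
    proof (cases "a = m")
      case True
      then show ?thesis by (simp add: Y_def)
    next
      case False
      then obtain r where r: "r \<in> S" "a + r \<in> P" "le (a + r) m"
        using up[of a m] Suc.prems mP by blast
      have "ht (a + r) = ht a + 1" using r Suc.prems by (simp add: ht_add spans ht_base)
      moreover have "le s (a + r)"
        using le_trans[OF \<open>le s a\<close> le_add[of a r]] r SP Suc.prems by (simp add: spans)
      ultimately have "Y (a + r)" using Suc.IH[of "a + r"] Suc.prems r by simp
      then show ?thesis using Y_any[of "a + r" a] Suc.prems r SP cf_le by auto
    qed
  qed
  have "cf m s \<ge> 1"
  proof -
    have "cf m s \<in> \<int>" "cf m s \<ge> 0" using cf_int PR mP s by (auto simp: P_iff)
    then show ?thesis using mC by (auto elim!: Ints_cases)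
  qed
  then have "le s m" using mP s by (auto simp: le_def cf_base P_iff)
  then have Ys: "Y s" using reach[OF _ SP[OF s(1)] le_refl] real_arch_simple by blast
  have "\<not> (\<exists>\<beta>\<in>B. \<beta> + y \<in> P \<and> le (\<alpha> + s) (\<beta> + y))" if "Y y" for y
    using that unfolding Y_def
  proof (induction rule: rtranclp_induct)
    case base
    show ?case
    proof
      assume "\<exists>\<beta>\<in>B. \<beta> + m \<in> P \<and> le (\<alpha> + s) (\<beta> + m)"
      then show False using tripartition_add[OF tBCA _ mC(1)] aboves by blast
    qed
  next
    case (step y z)
    let ?k = "y - z"
    have Yy: "Y y" using step by (simp add: Y_def)
    have yP: "y \<in> P" "le y m" using YP Yy by auto
    have kC: "?k \<in> C" and zP: "z \<in> P" using step by auto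
    have kP: "?k \<in> P" using kC sub by auto
    show ?case
    proof
      assume "\<exists>\<beta>\<in>B. \<beta> + z \<in> P \<and> le (\<alpha> + s) (\<beta> + z)"
      then obtain \<beta> where b: "\<beta> \<in> B" "\<beta> + z \<in> P" "le (\<alpha> + s) (\<beta> + z)" by blast
      have bP: "\<beta> \<in> P" using b sub by auto
      \<comment> \<open>If \<open>\<beta> + y\<close> is a root, \<beta> itself serves for
        \<open>y\<close>. If \<open>\<beta> - ?k\<close> is a positive root, it lies in
        \<open>B\<close> by co-closedness and serves for \<open>y\<close> with the same sum. If
        \<open>?k - \<beta>\<close> is positive, then \<open>y\<close>, and with it
        \<open>m\<close>, lies above \<open>\<alpha> + s\<close>, so \<open>m\<close> would be in
        \<open>A\<close>.\<close>
      have "\<beta> + z + ?k \<in> R \<union> {0} \<or> \<beta> - ?k \<in> R \<union> {0}"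
        using jacobi2[of \<beta> z ?k] b bP zP kP yP PR by simp
      moreover have "\<beta> + z + ?k \<noteq> 0" using P_add_nz b kP by blast
      moreover have "\<beta> - ?k \<noteq> 0" using tripartitionD[OF t] b kC by auto
      ultimately consider "\<beta> + y \<in> R" | "\<beta> - ?k \<in> R" by auto
      then show False
      proof cases
        case 1
        then have 2: "\<beta> + y \<in> P" using P_add bP yP by blast
        moreover have "le (\<beta> + z) (\<beta> + z + ?k)" using b kP by (intro le_add) (auto simp: spans)
        ultimately show False using step.IH b le_trans by auto
      next
        case 2
        show False
        proof (cases "\<beta> - ?k \<in> P")
          case True
          have "\<beta> - ?k \<in> B"
          proof (rule ccontr)
            have kB: "?k \<notin> B" using tripartitionD(7)[OF t] kC by blast
            assume "\<beta> - ?k \<notin> B"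
            then have "(\<beta> - ?k) + ?k \<notin> B"
              using inversion_setD(3)[of B "\<beta> - ?k" ?k] True kP kB t by (simp add: tripartition_def)
            then show False using b by simp
          qed
          moreover have "(\<beta> - ?k) + y = \<beta> + z" by simp
          ultimately show False using step.IH b by (metis (no_types, lifting))
        next
          case False
          then have w: "?k - \<beta> \<in> P" using R_cases[OF 2] by simp
          have "le (\<beta> + z) (\<beta> + z + (?k - \<beta>))" using w b by (intro le_add) (auto simp: spans)
          then have "le (\<alpha> + s) y" using le_trans[OF b(3)] by simp
          then have "le (\<alpha> + s) m" using le_trans yP by blast
          then have "m \<in> A" using aboves mP by blast
          then show False using tripartitionD[OF t] mC by blast
        qed
      qed
    qed
  qed
  then show False using Ys al s le_refl by blast
qed

text \<open>First stage of the proof. A root \<alpha> of maximal height in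
  \<open>B \<union> C\<close> is not \<open>h\<close>, so \<open>up\<close> yields a simple
  \<open>s\<close> with \<open>\<alpha> + s\<close> a root; the part not containing \<alpha> then
  avoids \<open>s\<close>.\<close>

lemma supp_not_full:
  assumes t: "tripartition A B C" and h: "h \<in> A" "highest_root R S h" and ne: "B \<union> C \<noteq> {}"
  shows "\<exists>s\<in>S. (\<forall>x\<in>B. cf x s = 0) \<or> (\<forall>x\<in>C. cf x s = 0)"
proof -
  have "finite (B \<union> C)" using fin tripartitionD[OF t] PR by (auto intro!: finite_subset[of _ R])
  then obtain \<alpha> where al: "is_arg_min (\<lambda>x. - ht x) (\<lambda>x. x \<in> B \<union> C) \<alpha>"
    using ex_is_arg_min_if_finite[of "B \<union> C" "\<lambda>x. - ht x"] ne by blast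
  then have al1: "\<alpha> \<in> B \<union> C" and max: "\<And>x. x \<in> B \<union> C \<Longrightarrow> ht x \<le> ht \<alpha>"
    by (auto simp: is_arg_min_linorder)
  have aP: "\<alpha> \<in> P" using al1 tripartitionD[OF t] by auto
  have hP: "h \<in> P" using h tripartitionD[OF t] by auto
  have "le \<alpha> h"
    using h(2) aP hP by (auto simp: highest_root_def coef_le_def nonneg_int_comb_iff le_def cf_diff spans)
  moreover have "\<alpha> \<noteq> h" using al1 h tripartitionD[OF t] by auto
  ultimately obtain s where s: "s \<in> S" "\<alpha> + s \<in> P" using up aP hP by blast
  from al1 show ?thesis
  proof
    assume "\<alpha> \<in> B"
    then show ?thesis using supp_not_full_aux[OF t _ max s] s(1) by blast
  next
    assume "\<alpha> \<in> C"
    then show ?thesis using supp_not_full_aux[OF tripartition_swap[OF t] _ _ s] max s(1) by (metis Un_commute)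
  qed
qed

section \<open>Inflations and primitive sets\<close>

text \<open>The sign of a lift has to be recovered from its projection: a negative lift would have
  coordinates outside \<open>I\<close> that are both non-positive and non-negative, so it would lie
  in \<open>span I\<close> and project to 0.\<close>

lemma pos_quot:
  assumes "I \<subseteq> S"
  shows "pos (quot_rs R I) (quot_base S I) = qproj I ` (P - span I)"
proof
  show "qproj I ` (P - span I) \<subseteq> pos (quot_rs R I) (quot_base S I)"
  proof
    fix v assume "v \<in> qproj I ` (P - span I)"
    then obtain a where a: "a \<in> P" "a \<notin> span I" "v = qproj I a" by auto
    then have "nonneg_int_comb (quot_base S I) v"
      unfolding quot_base_def using nonneg_int_comb_qproj[OF finS, of a I] by (simp add: pos_def)
    moreover have "v \<in> qproj I ` R - {0}" using a PR by (simp add: qproj_eq_0_iff)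
    ultimately show "v \<in> pos (quot_rs R I) (quot_base S I)"
      by (simp add: pos_def quot_rs_def)
  qed
  show "pos (quot_rs R I) (quot_base S I) \<subseteq> qproj I ` (P - span I)"
  proof
    fix v assume "v \<in> pos (quot_rs R I) (quot_base S I)"
    then obtain a where a: "a \<in> R" "v = qproj I a" "v \<noteq> 0"
      and c: "nonneg_int_comb (qproj I ` (S - I)) v"
      by (auto simp: pos_def quot_rs_def quot_base_def)
    have nI: "a \<notin> span I" using a by (auto simp: qproj_eq_0_iff)
    have "a \<in> P"
    proof (rule ccontr)
      assume "a \<notin> P"
      then have na: "- a \<in> P" using R_cases a by blast
      let ?T = "qproj I ` (S - I)"
      obtain c :: "'a \<Rightarrow> int" where c: "\<forall>t\<in>?T. c t \<ge> 0" "v = (\<Sum>t\<in>?T. of_int (c t) *\<^sub>R t)"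
        using c by (auto simp: nonneg_int_comb_def)
      \<comment> \<open>\<open>g\<close> chooses a simple root above each element of the quotient
        base; \<open>w\<close> is then a lift of \<open>v\<close> with non-negative
        coordinates.\<close>
      define g where "g = inv_into (S - I) (qproj I)"
      have g: "g t \<in> S - I" "qproj I (g t) = t" if "t \<in> ?T" for t
        unfolding g_def using inv_into_into[OF that] f_inv_into_f[OF that] by simp_all
      have gS: "g t \<in> span S" if "t \<in> ?T" for t using g[OF that] by (simp add: span_base)
      define w where "w = (\<Sum>t\<in>?T. of_int (c t) *\<^sub>R g t)"
      have wS: "w \<in> span S" unfolding w_def using gS by (intro span_sum span_scale)
      have "qproj I w = v"
        unfolding w_def c(2) using g by (simp add: qproj_sum qproj_scale)
      then have aw: "a - w \<in> span I" using a qproj_eq_iff[of I a w] by simp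
      have "cf a s = 0" if s: "s \<in> S - I" for s
      proof -
        have "cf (a - w) s = 0" using span_sub_iff[OF assms, of "a - w"] aw s a wS by (simp add: spans)
        then have "cf a s = cf w s" using a wS by (simp add: cf_diff spans)
        also have "\<dots> = (\<Sum>t\<in>?T. cf (of_int (c t) *\<^sub>R g t) s)"
          unfolding w_def using ind gS
          by (subst real_vector.representation_sum) (simp_all add: span_scale)
        also have "\<dots> \<ge> 0"
        proof (rule sum_nonneg)
          fix t assume t: "t \<in> ?T"
          have "cf (of_int (c t) *\<^sub>R g t) s = of_int (c t) * cf (g t) s"
            using gS[OF t] ind by (subst real_vector.representation_scale) simp_all
          then show "0 \<le> cf (of_int (c t) *\<^sub>R g t) s"
            using c(1) t g[OF t] by (auto simp: cf_base)
        qed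
        finally have "cf a s \<ge> 0" .
        moreover have "- cf a s \<ge> 0" using na s a by (auto simp: P_iff cf_neg spans)
        ultimately show ?thesis by simp
      qed
      then show False using span_sub_iff[OF assms, of a] nI a by (simp add: spans)
    qed
    then show "v \<in> qproj I ` (P - span I)" using a nI by auto
  qed
qed

text \<open>Turns saturation of \<Psi> under the fibres of the projection along \<open>H\<close>
  into an inflation inside \<open>R/I\<close>, from the image \<open>K\<close> of
  \<open>H - I\<close>. The strict inclusions make \<open>K\<close> neither empty nor the whole
  base.\<close>

lemma not_primitive:
  assumes IH: "I \<subset> H" "H \<subset> S" and \<Psi>: "\<Psi> \<subseteq> pos (quot_rs R I) (quot_base S I)"
    and fib: "\<And>a b. a \<in> P \<Longrightarrow> b \<in> P \<Longrightarrow> b \<notin> span H \<Longrightarrow> a - b \<in> span H \<Longrightarrow>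
      qproj I b \<in> \<Psi> \<Longrightarrow> qproj I a \<in> \<Psi>"
  shows "\<not> primitive (quot_rs R I) (quot_base S I) \<Psi>"
proof
  assume prim: "primitive (quot_rs R I) (quot_base S I) \<Psi>"
  let ?Q = "quot_rs R I" and ?T = "quot_base S I"
  have IS: "I \<subseteq> S" using IH by auto
  define K where "K = qproj I ` (H - I)"
  define \<Psi>' where "\<Psi>' = qproj K ` (\<Psi> - span K)"
  have span_K: "qproj I v \<in> span K \<longleftrightarrow> v \<in> span H" for v
    unfolding K_def using IH by (intro qproj_mem_span_image) auto
  have KT: "K \<subseteq> ?T" using IH by (auto simp: K_def quot_base_def)
  have pos': "\<Psi>' \<subseteq> pos (quot_rs ?Q K) (quot_base ?T K)"
  proof
    fix v assume "v \<in> \<Psi>'"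
    then obtain p where p: "p \<in> \<Psi>" "p \<notin> span K" "v = qproj K p" by (auto simp: \<Psi>'_def)
    then have "p \<in> pos ?Q ?T" using \<Psi> by blast
    then have "p \<in> ?Q" "nonneg_int_comb ?T p" by (auto simp: pos_def)
    moreover have "finite ?T" using finS by (simp add: quot_base_def)
    ultimately show "v \<in> pos (quot_rs ?Q K) (quot_base ?T K)"
      using p nonneg_int_comb_qproj[of ?T p K] unfolding pos_def quot_rs_def[of ?Q] quot_base_def[of ?T]
      by (simp add: qproj_eq_0_iff)
  qed
  have "\<Psi> = infl ?Q ?T K \<Psi>' (\<Psi> \<inter> span K)"
  proof (intro equalityI subsetI)
    fix v assume "v \<in> \<Psi>"
    then show "v \<in> infl ?Q ?T K \<Psi>' (\<Psi> \<inter> span K)"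
      using \<Psi> by (cases "v \<in> span K") (auto simp: infl_def \<Psi>'_def)
  next
    fix v assume "v \<in> infl ?Q ?T K \<Psi>' (\<Psi> \<inter> span K)"
    then consider "v \<in> \<Psi>" | "v \<in> pos ?Q ?T" "qproj K v \<in> \<Psi>'" by (auto simp: infl_def)
    then show "v \<in> \<Psi>"
    proof cases
      case 2
      obtain p where p: "p \<in> \<Psi>" "p \<notin> span K" "qproj K v = qproj K p" using 2 by (auto simp: \<Psi>'_def)
      obtain a where a: "a \<in> P" "v = qproj I a" using 2 pos_quot[OF IS] by auto
      obtain b where b: "b \<in> P" "p = qproj I b" using p \<Psi> pos_quot[OF IS] by blast
      have "b \<notin> span H" using p b span_K by blast
      moreover have "qproj I (a - b) \<in> span K" using p a b by (simp add: qproj_eq_iff qproj_diff)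
      then have "a - b \<in> span H" using span_K by blast
      ultimately show ?thesis using fib[OF a(1) b(1)] p a b by blast
    qed
  qed
  moreover have "\<Psi> \<inter> span K \<subseteq> sub_rs ?Q K \<inter> pos ?Q ?T"
    using \<Psi> by (auto simp: sub_rs_def pos_def)
  ultimately have "K = {} \<or> K = ?T"
    using prim KT pos' unfolding primitive_def by blast
  then show False
  proof
    assume "K = {}"
    then show False using IH by (auto simp: K_def)
  next
    \<comment> \<open>Some \<open>s\<close> outside \<open>H\<close> would have the same image as
      some \<open>u\<close> in \<open>H - I\<close>, contradicting the independence of
      \<open>S\<close>.\<close>
    assume eq: "K = ?T"
    obtain s where s: "s \<in> S" "s \<notin> H" using IH by blast
    then have "qproj I s \<in> K" using eq IH by (auto simp: quot_base_def)
    then obtain u where u: "u \<in> H - I" "s - u \<in> span I" by (auto simp: K_def qproj_eq_iff)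
    have "u \<in> S" "s \<in> S - I" "u \<noteq> s" using u s IH by auto
    moreover have "cf (s - u) s = 0"
      using span_sub_iff[OF IS, of "s - u"] u calculation by (simp add: spans)
    ultimately show False by (auto simp: cf_diff spans cf_base)
  qed
qed

lemma connectedD:
  assumes "qrs_connected S" "W \<subseteq> S" "W \<noteq> {}" "W \<noteq> S"
  shows "\<exists>w\<in>W. \<exists>t\<in>S - W. w \<bullet> t \<noteq> 0"
proof (rule ccontr)
  assume no: "\<not> ?thesis"
  obtain w t where wt: "w \<in> W" "t \<in> S - W" using assms by blast
  then have "(\<lambda>x y. x \<in> S \<and> y \<in> S \<and> x \<bullet> y < 0)\<^sup>*\<^sup>* w t"
    using assms by (auto simp: qrs_connected_def)
  then have "t \<in> W"
  proof (induction rule: rtranclp_induct)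
    case base
    then show ?case using wt by simp
  next
    case (step y z)
    then show ?case using no by force
  qed
  then show False using wt by blast
qed

lemma base_obtuse:
  assumes "s \<in> S" "t \<in> S" "s \<noteq> t" shows "s \<bullet> t \<le> 0"
proof (rule ccontr)
  assume "\<not> s \<bullet> t \<le> 0"
  then have r: "s - t \<in> R" using diff_R[of s t] assms base by auto
  have "cf (s - t) s = 1" "cf (s - t) t = -1"
    using assms by (auto simp: cf_diff spans cf_base)
  then show False
    using P_if_coord[OF r assms(1)] assms by (auto simp: P_iff)
qed

lemma notin_span_add:
  assumes "K \<subseteq> S" "a \<in> P" "a \<notin> span K" "b \<in> P" shows "a + b \<notin> span K"
proof -
  obtain s where s: "s \<in> S - K" "cf a s \<noteq> 0" using assms span_sub_iff[of K a] by (auto simp: spans)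
  then have "cf a s > 0" "cf b s \<ge> 0" using assms by (auto simp: P_iff less_le)
  then have "cf (a + b) s > 0" using assms by (simp add: cf_add spans)
  then show ?thesis using span_sub_iff[of K "a + b"] s assms by (auto simp: spans)
qed

text \<open>\<open>A\<close> is inflated from \<open>I\<close> and from \<open>K = supp C\<close>, hence from \<open>I \<union> K\<close>. If \<open>I \<union> K = S\<close>, every
  root outside both spans lies in \<open>A\<close>; the roots outside \<open>A\<close> that are maximal in their fibre of
  \<open>\<pi>\<^sub>I\<close> then have supports orthogonal to the rest of \<open>I\<close>, so that connectedness of \<open>S\<close> yields another
  proper \<open>H \<supset> I\<close> from which \<open>A\<close> is inflated.\<close>

lemma block_aux:
  assumes t: "tripartition A B C" and h: "h \<in> A" "highest_root R S h" and conn: "qrs_connected S"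
    and IS: "I \<subset> S" and prim: "primitive (quot_rs R I) (quot_base S I) \<Psi>"
    and mem: "\<And>a. a \<in> P \<Longrightarrow> a \<notin> span I \<Longrightarrow> a \<in> A \<longleftrightarrow> qproj I a \<in> \<Psi>"
    and s0: "s0 \<in> S" "\<forall>x\<in>C. cf x s0 = 0"
  shows "C \<subseteq> span I"
proof (rule ccontr)
  assume nC: "\<not> C \<subseteq> span I"
  have IS': "I \<subseteq> S" using IS by auto
  have \<Psi>: "\<Psi> \<subseteq> pos (quot_rs R I) (quot_base S I)" "\<Psi> \<noteq> pos (quot_rs R I) (quot_base S I)"
    using prim by (auto simp: primitive_def)
  note sub = tripartitionD(1-3)[OF t]
  define K where "K = {s \<in> S. \<exists>x\<in>C. cf x s \<noteq> 0}"
  have KS: "K \<subseteq> S" and s0K: "s0 \<notin> K" using s0 by (auto simp: K_def)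
  have CK: "C \<subseteq> span K"
  proof
    fix x assume "x \<in> C"
    then show "x \<in> span K" using span_sub_iff[OF KS, of x] sub by (auto simp: spans K_def)
  qed
  have nKI: "\<not> K \<subseteq> I" using CK nC span_mono by blast
  have Kstep: "a \<in> A \<longleftrightarrow> a + s \<in> A"
    if "a \<in> P" "a \<notin> span K" "s \<in> K" "a + s \<in> R" for a s
    using supp_invariant[OF t KS CK] that by (auto simp: K_def)
  have Istep: "a \<in> A \<longleftrightarrow> a + s \<in> A"
    if a: "a \<in> P" "a \<notin> span I" "s \<in> I" "a + s \<in> R" for a s
  proof -
    have sI: "s \<in> span I" using a by (simp add: span_base)
    then have "a + s \<in> P" "a + s \<notin> span I" using fibre_closed[OF IS' a(1,2,4)] by auto
    moreover have "qproj I (a + s) = qproj I a" using sI by (simp add: qproj_eq_iff)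
    ultimately show ?thesis using mem a by simp
  qed
  \<comment> \<open>Reduces the remaining work to finding \<open>H\<close> strictly between
    \<open>I\<close> and \<open>S\<close> such that, outside \<open>span H\<close>, \<open>A\<close>
    is a union of fibres of the projection along \<open>H\<close>.\<close>
  have HC: False if H: "I \<subset> H" "H \<subset> S"
    and fib: "\<And>a b. a \<in> P \<Longrightarrow> a \<notin> span H \<Longrightarrow> b \<in> P \<Longrightarrow> a - b \<in> span H \<Longrightarrow> b \<in> A \<Longrightarrow> a \<in> A" for H
  proof -
    have HS: "H \<subseteq> S" and IH: "span I \<subseteq> span H" using H by (auto intro!: span_mono)
    have "qproj I a \<in> \<Psi>"
      if a: "a \<in> P" "b \<in> P" "b \<notin> span H" "a - b \<in> span H" "qproj I b \<in> \<Psi>" for a b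
    proof -
      have "a \<notin> span H" using fibre_closed[OF HS a(2,3) PR[OF a(1)]] a by blast
      moreover have "b \<in> A" using mem a IH by blast
      ultimately show ?thesis using fib a mem IH by blast
    qed
    then show False using not_primitive[OF H \<Psi>(1)] prim by blast
  qed
  show False
  proof (cases "I \<union> K = S")
    case False
    have HS: "I \<union> K \<subseteq> S" using IS KS by auto
    have sp: "span I \<subseteq> span (I \<union> K)" "span K \<subseteq> span (I \<union> K)" by (auto intro!: span_mono)
    show False
    proof (rule HC[of "I \<union> K"])
      fix a b assume ab: "a \<in> P" "a \<notin> span (I \<union> K)" "b \<in> P" "a - b \<in> span (I \<union> K)" "b \<in> A"
      have "a \<in> A \<longleftrightarrow> b \<in> A"
        by (rule fibre_connected[OF HS ab(1-4)]) (use sp Istep Kstep in blast)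
      then show "a \<in> A" using ab by blast
    qed (use False HS nKI in auto)
  next
    case True
    have hP: "h \<in> P" using h sub by auto
    have leh: "le a h" if "a \<in> P" for a
      using h(2) that hP
      by (auto simp: highest_root_def coef_le_def nonneg_int_comb_iff le_def cf_diff spans)
    \<comment> \<open>Climbing to \<open>h\<close> by simple roots stays outside both spans. Each
      simple root is in \<open>I\<close> or \<open>K\<close>, so membership in \<open>A\<close>
      passes back from \<open>h\<close>.\<close>
    have out': "ht h - ht a \<le> real n \<Longrightarrow> a \<in> P \<Longrightarrow> a \<notin> span I \<Longrightarrow> a \<notin> span K \<Longrightarrow> a \<in> A" for n a
    proof (induction n arbitrary: a)
      case (0 a)
      then have "a = h" using ht_mono_strict[of a h] leh[of a] hP by (force simp: spans)
      then show ?case using h by simp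
    next
      case (Suc n a)
      show ?case
      proof (cases "a = h")
        case False
        then obtain s where s: "s \<in> S" "a + s \<in> P" using up[of a h] leh Suc.prems hP by blast
        have "ht (a + s) = ht a + 1" using s Suc.prems by (simp add: ht_add spans ht_base)
        then have "a + s \<in> A"
          using Suc.IH[of "a + s"] Suc.prems s SP notin_span_add IS' KS by auto
        then show ?thesis using Istep Kstep Suc.prems s True PR by blast
      qed (use h in simp)
    qed
    have out: "a \<in> A" if "a \<in> P" "a \<notin> span I" "a \<notin> span K" for a
      using out' that real_arch_simple by blast
    define M where "M = {b \<in> P. b \<notin> span I \<and> b \<notin> A \<and> (\<forall>s\<in>I. b + s \<notin> R)}"
    have toM: "\<exists>b\<in>M. a - b \<in> span I" if a: "a \<in> P" "a \<notin> span I" "a \<notin> A" for a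
    proof -
      let ?F = "{b \<in> P. a - b \<in> span I}"
      have "finite ?F" using fin PR by (auto intro!: finite_subset[of _ R])
      moreover have "a \<in> ?F" using a by (simp add: span_zero)
      ultimately obtain b where "is_arg_min (\<lambda>x. - ht x) (\<lambda>x. x \<in> ?F) b"
        using ex_is_arg_min_if_finite[of ?F "\<lambda>x. - ht x"] by blast
      then have b: "b \<in> P" "a - b \<in> span I" and max: "\<And>c. c \<in> P \<Longrightarrow> a - c \<in> span I \<Longrightarrow> ht c \<le> ht b"
        by (auto simp: is_arg_min_linorder)
      have "b - a \<in> span I" using b span_neg[of "a - b" I] by simp
      then have bI: "b \<notin> span I" using fibre_closed[OF IS' a(1,2) PR[OF b(1)]] by blast
      have "qproj I a = qproj I b" using b by (simp add: qproj_eq_iff)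
      then have bA: "b \<notin> A" using mem a b bI by auto
      have "b + s \<notin> R" if s: "s \<in> I" for s
      proof
        assume "b + s \<in> R"
        then have bs: "b + s \<in> P" using P_add b s SP IS' by blast
        have "a - (b + s) \<in> span I"
          using span_diff[OF b(2) span_base[OF s]] by (simp add: algebra_simps)
        then have "ht (b + s) \<le> ht b" using max bs by blast
        moreover have "ht (b + s) = ht b + 1" using b s IS' by (auto simp: ht_add spans ht_base)
        ultimately show False by simp
      qed
      then show ?thesis using b bI bA by (auto simp: M_def)
    qed
    define W where "W = {s \<in> S. \<exists>b\<in>M. cf b s \<noteq> 0}"
    have WS: "W \<subseteq> S" by (auto simp: W_def)
    have MW: "b \<in> span W" if "b \<in> M" for b
      using span_sub_iff[OF WS, of b] that by (auto simp: M_def W_def spans)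
    \<comment> \<open>By \<open>out\<close>, elements of \<open>M\<close> lie in
      \<open>span K\<close>, and \<open>s0\<close> is not in \<open>K\<close>.\<close>
    have "s0 \<notin> W"
    proof
      assume "s0 \<in> W"
      then obtain b where b: "b \<in> M" "cf b s0 \<noteq> 0" by (auto simp: W_def)
      then have "b \<in> span K" using out by (auto simp: M_def)
      then show False using span_sub_iff[OF KS, of b] b s0 s0K by (auto simp: M_def spans)
    qed
    then have WS': "W \<noteq> S" using s0 by blast
    \<comment> \<open>As \<open>b + u\<close> is not a root, \<open>u \<bullet> b \<ge> 0\<close>.
      Since \<open>u\<close> is not in the support of \<open>b\<close>, every term of its expansion
      is non-positive, so each one vanishes.\<close>
    have orth: "w \<bullet> u = 0" if w: "w \<in> W" and u: "u \<in> I" "u \<notin> W" for w u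
    proof -
      obtain b where b: "b \<in> M" "cf b w \<noteq> 0" using w by (auto simp: W_def)
      have bP: "b \<in> P" and bu: "b + u \<notin> R" using b u by (auto simp: M_def)
      have uS: "u \<in> S" and wS: "w \<in> S" using u w IS' WS by auto
      have b0: "cf b u = 0" using b u uS by (auto simp: W_def)
      have "b + u \<noteq> 0" using P_add_nz bP SP uS by blast
      then have "u \<bullet> b \<ge> 0"
        using add_R[of b u] bP uS base PR bu by (force simp: inner_commute)
      then have sum: "(\<Sum>s\<in>S. cf b s * (u \<bullet> s)) \<ge> 0" using inner_cf[of b u] bP by (simp add: spans)
      have np: "cf b s * (u \<bullet> s) \<le> 0" if "s \<in> S" for s
        using b0 base_obtuse[OF uS that] that bP
        by (cases "s = u") (auto simp: P_iff mult_nonneg_nonpos)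
      have "cf b w * (u \<bullet> w) = 0"
      proof (rule ccontr)
        assume "cf b w * (u \<bullet> w) \<noteq> 0"
        then have "cf b w * (u \<bullet> w) < 0" using np[OF wS] by linarith
        then have "(\<Sum>s\<in>S. cf b s * (u \<bullet> s)) < (\<Sum>s\<in>S. 0)"
          using np wS finS by (intro sum_strict_mono_ex1) auto
        then show False using sum by simp
      qed
      then show ?thesis using b by (simp add: inner_commute)
    qed
    obtain p where "p \<in> qproj I ` (P - span I)" "p \<notin> \<Psi>"
      using \<Psi> unfolding pos_quot[OF IS'] by blast
    then obtain a where a: "a \<in> P" "a \<notin> span I" "a \<notin> A" using mem by blast
    then obtain b where b: "b \<in> M" using toM by blast
    have "b \<notin> span I" using b by (simp add: M_def)
    then have nWI: "\<not> W \<subseteq> I" using MW[OF b] span_mono by blast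
    show False
    proof (cases "I \<union> W = S")
      case True
      then show False using connectedD[OF conn WS _ WS'] orth nWI by blast
    next
      case False
      show False
      \<comment> \<open>Here all positive roots outside \<open>span (I \<union> W)\<close> lie in
        \<open>A\<close>: another one would share a fibre with an element of \<open>M\<close>, which
        lies in \<open>span W\<close>.\<close>
      proof (rule HC[of "I \<union> W"])
        fix a b assume ab: "a \<in> P" "a \<notin> span (I \<union> W)"
        show "a \<in> A"
        proof (rule ccontr)
          assume nA: "a \<notin> A"
          have sp: "span I \<subseteq> span (I \<union> W)" "span W \<subseteq> span (I \<union> W)" by (auto intro!: span_mono)
          then obtain c where c: "c \<in> M" "a - c \<in> span I" using toM ab nA by blast
          then have "(a - c) + c \<in> span (I \<union> W)" using MW[OF c(1)] sp by (intro span_add) auto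
          then show False using ab by simp
        qed
      qed (use False IS' WS nWI in auto)
    qed
  qed
qed

lemma block_unique:
  assumes t: "tripartition A B C" and h: "h \<in> A" "highest_root R S h" and conn: "qrs_connected S"
    and IS: "I \<subset> S" and prim: "primitive (quot_rs R I) (quot_base S I) \<Psi>"
    and mem: "\<And>a. a \<in> P \<Longrightarrow> a \<notin> span I \<Longrightarrow> a \<in> A \<longleftrightarrow> qproj I a \<in> \<Psi>"
  shows "B \<subseteq> span I \<or> C \<subseteq> span I"
proof (cases "B \<union> C = {}")
  case False
  then obtain s where s: "s \<in> S" "(\<forall>x\<in>B. cf x s = 0) \<or> (\<forall>x\<in>C. cf x s = 0)"
    using supp_not_full[OF t h] by blast
  then show ?thesis
    using block_aux[OF t h conn IS prim mem s(1)]
      block_aux[OF tripartition_swap[OF t] h conn IS prim mem s(1)] by blast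
qed auto

section \<open>Merging parts and the decomposition theorem\<close>

text \<open>A sum of elements from selected parts cannot land in an unselected part, because that
  part is co-closed. The complement is again a union of parts, so the same argument gives
  co-closedness.\<close>

lemma inversion_set_UN:
  assumes inv: "\<And>i. i \<in> N \<Longrightarrow> inversion_set R S (\<Phi> i)"
    and dis: "\<And>i j. i \<in> N \<Longrightarrow> j \<in> N \<Longrightarrow> i \<noteq> j \<Longrightarrow> \<Phi> i \<inter> \<Phi> j = {}"
    and un: "(\<Union>i\<in>N. \<Phi> i) = P" and JN: "J \<subseteq> N"
  shows "inversion_set R S (\<Union>i\<in>J. \<Phi> i)"
proof -
  have cl: "closed_rs R (\<Union>i\<in>L. \<Phi> i)" if LN: "L \<subseteq> N" for L
    unfolding closed_rs_def
  proof (intro ballI impI)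
    fix a b assume a: "a \<in> (\<Union>i\<in>L. \<Phi> i)" and b: "b \<in> (\<Union>i\<in>L. \<Phi> i)" and ab: "a + b \<in> R"
    obtain i j where ij: "i \<in> L" "j \<in> L" "a \<in> \<Phi> i" "b \<in> \<Phi> j" using a b by auto
    have P: "a \<in> P" "b \<in> P" using ij LN un by auto
    then obtain k where k: "k \<in> N" "a + b \<in> \<Phi> k" using P_add[OF _ _ ab] un by blast
    have "k \<in> L"
    proof (rule ccontr)
      assume "k \<notin> L"
      then have "a \<notin> \<Phi> k" "b \<notin> \<Phi> k" using dis[of i k] dis[of j k] ij k LN by auto
      then show False using inversion_setD(3)[OF inv[OF k(1)], of a b] P k by blast
    qed
    then show "a + b \<in> (\<Union>i\<in>L. \<Phi> i)" using k by blast
  qed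
  have "P - (\<Union>i\<in>J. \<Phi> i) = (\<Union>i\<in>N - J. \<Phi> i)"
  proof (intro equalityI subsetI)
    fix x assume "x \<in> (\<Union>i\<in>N - J. \<Phi> i)"
    then obtain i where i: "i \<in> N - J" "x \<in> \<Phi> i" by blast
    then have "x \<notin> \<Phi> j" if "j \<in> J" for j using dis[of i j] that JN by blast
    then show "x \<in> P - (\<Union>i\<in>J. \<Phi> i)" using i un by blast
  qed (use un in blast)
  moreover have "(\<Union>i\<in>J. \<Phi> i) \<subseteq> P" using JN un by blast
  ultimately show ?thesis
    using cl[OF JN] cl[of "N - J"] by (simp add: inversion_set_def)
qed

end

theorem theorem5p9:
  fixes R S :: "'a::euclidean_space set"
    and \<Phi> :: "nat \<Rightarrow> 'a set" and n :: nat
    and I \<Psi> X1 :: "'a set" and h :: 'a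
  assumes "qrs R S" and "qrs_connected S"
    and "n \<ge> 1"
    and "\<forall>i\<in>{1..n}. \<Phi> i \<noteq> {} \<and> inversion_set R S (\<Phi> i)"
    and "\<forall>i\<in>{1..n}. \<forall>j\<in>{1..n}. i \<noteq> j \<longrightarrow> \<Phi> i \<inter> \<Phi> j = {}"
    and "(\<Union>i\<in>{1..n}. \<Phi> i) = pos R S"
    and "highest_root R S h" and "h \<in> \<Phi> 1"
    and "canonical_form R S (\<Phi> 1) I \<Psi> X1"
  shows "\<exists>\<sigma> X. bij_betw \<sigma> {2..n} {2..n} \<and>
           (\<forall>i\<in>{2..n}. X i \<subseteq> sub_rs R I \<inter> pos R S) \<and>
           (n \<ge> 2 \<longrightarrow> \<Phi> (\<sigma> 2) =
              infl R S I (pos (quot_rs R I) (quot_base S I) - \<Psi>) (X 2)) \<and>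
           (\<forall>i\<in>{3..n}. \<Phi> (\<sigma> i) = infl R S I {} (X i))"
proof -
  interpret root_like R S using assms(1) by (rule qrs_root_like)
  let ?Q = "pos (quot_rs R I) (quot_base S I)"
  have inv: "\<And>i. i \<in> {1..n} \<Longrightarrow> inversion_set R S (\<Phi> i)"
    and dis: "\<And>i j. i \<in> {1..n} \<Longrightarrow> j \<in> {1..n} \<Longrightarrow> i \<noteq> j \<Longrightarrow> \<Phi> i \<inter> \<Phi> j = {}"
    using assms(4,5) by auto
  note un = assms(6)
  have \<Phi>P: "\<Phi> i \<subseteq> P" if "i \<in> {1..n}" for i using un that by blast
  have 1: "1 \<in> {1..n}" using assms(3) by simp
  have IS: "I \<subset> S" and IS': "I \<subseteq> S" and X1: "X1 \<subseteq> sub_rs R I"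
    and eq1: "\<Phi> 1 = infl R S I \<Psi> X1"
    and cases: "primitive (quot_rs R I) (quot_base S I) \<Psi> \<or> \<Psi> \<in> {{}, ?Q}"
    using assms(9) by (auto simp: canonical_form_def)
  have mem: "a \<in> \<Phi> 1 \<longleftrightarrow> qproj I a \<in> \<Psi>" if "a \<in> P" "a \<notin> span I" for a
    unfolding eq1 infl_def using that X1 by (auto simp: sub_rs_def)
  have hP: "h \<in> P" using assms(8) \<Phi>P[OF 1] by blast
  \<comment> \<open>The highest root dominates a simple root outside \<open>I\<close>. This excludes
    \<open>\<Psi> = {}\<close> in the canonical form.\<close>
  have hI: "h \<notin> span I"
  proof
    assume "h \<in> span I"
    obtain s where s: "s \<in> S - I" using IS by blast
    then have "cf (h - s) s \<ge> 0"
      using assms(7) SP by (auto simp: highest_root_def coef_le_def nonneg_int_comb_iff)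
    then have "cf h s \<ge> 1" using s hP by (auto simp: cf_diff spans cf_base)
    then show False using span_sub_iff[OF IS', of h] \<open>h \<in> span I\<close> s hP by (auto simp: spans)
  qed
  then have "\<Psi> \<noteq> {}" using mem hP assms(8) by auto
  then have cases': "primitive (quot_rs R I) (quot_base S I) \<Psi> \<or> \<Psi> = ?Q" using cases by auto
  have unique: "i = j"
    if i: "i \<in> {2..n}" "\<not> \<Phi> i \<subseteq> span I" and j: "j \<in> {2..n}" "\<not> \<Phi> j \<subseteq> span I" for i j
    using cases'
  proof
    assume "\<Psi> = ?Q"
    then have "a \<in> \<Phi> 1" if "a \<in> P" "a \<notin> span I" for a
      using mem that pos_quot[OF IS'] by blast
    then have "\<Phi> i \<subseteq> span I" using dis[of 1 i] i \<Phi>P[of i] 1 by fastforce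
    then show ?thesis using i by blast
  next
    assume prim: "primitive (quot_rs R I) (quot_base S I) \<Psi>"
    show ?thesis
    proof (rule ccontr)
      assume ne: "i \<noteq> j"
      \<comment> \<open>All parts other than the first and the \<open>i\<close>-th are merged, which
        reduces the claim to three parts.\<close>
      let ?C = "\<Union>k\<in>{1..n} - {1, i}. \<Phi> k"
      have i': "i \<in> {1..n}" "i \<noteq> 1" using i by auto
      have "inversion_set R S ?C" by (rule inversion_set_UN[OF inv dis un]) auto
      moreover have "\<Phi> 1 \<inter> ?C = {}" "\<Phi> i \<inter> ?C = {}" using dis 1 i' by blast+
      moreover have "\<Phi> 1 \<inter> \<Phi> i = {}" using dis 1 i' by blast
      moreover have "\<Phi> 1 \<union> \<Phi> i \<union> ?C = P" using un 1 i' by blast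
      ultimately have "tripartition (\<Phi> 1) (\<Phi> i) ?C" using inv 1 i' by (simp add: tripartition_def)
      then have "\<Phi> i \<subseteq> span I \<or> ?C \<subseteq> span I"
        using block_unique[OF _ assms(8,7,2) IS prim mem] by blast
      moreover have "\<Phi> j \<subseteq> ?C" using j ne by (intro UN_upper) auto
      ultimately show False using i j by blast
    qed
  qed
  show ?thesis
  proof (cases "n \<ge> 2")
    case False
    then show ?thesis by (intro exI[of _ id] exI[of _ "\<lambda>_. {}"]) auto
  next
    case n2: True
    \<comment> \<open>The only part besides the first that may leave \<open>span I\<close>; if there
      is none, the index 2 is taken.\<close>
    obtain k where k: "k \<in> {2..n}" and others: "\<And>i. i \<in> {2..n} \<Longrightarrow> i \<noteq> k \<Longrightarrow> \<Phi> i \<subseteq> span I"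
    proof (cases "\<exists>k\<in>{2..n}. \<not> \<Phi> k \<subseteq> span I")
      case True
      then show ?thesis using that unique by blast
    next
      case False
      then show ?thesis using that[of 2] n2 by auto
    qed
    \<comment> \<open>The transposition of 2 and \<open>k\<close>, which is its own inverse.\<close>
    define \<sigma> where "\<sigma> i = (if i = 2 then k else if i = k then 2 else i)" for i :: nat
    define X where "X i = \<Phi> (\<sigma> i) \<inter> span I" for i
    have \<sigma>in: "\<sigma> i \<in> {2..n}" if "i \<in> {2..n}" for i using that k n2 by (auto simp: \<sigma>_def)
    have "bij_betw \<sigma> {2..n} {2..n}"
      by (rule bij_betw_byWitness[where f' = \<sigma>]) (use k n2 in \<open>auto simp: \<sigma>_def\<close>)
    moreover have "\<forall>i\<in>{2..n}. X i \<subseteq> sub_rs R I \<inter> P"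
    proof
      fix i assume "i \<in> {2..n}"
      then have "\<Phi> (\<sigma> i) \<subseteq> P" using \<sigma>in[of i] by (intro \<Phi>P) auto
      then show "X i \<subseteq> sub_rs R I \<inter> P" using PR by (auto simp: X_def sub_rs_def)
    qed
    moreover have "\<Phi> (\<sigma> 2) = infl R S I (?Q - \<Psi>) (X 2)"
    proof -
      have kP: "\<Phi> k \<subseteq> P" using k by (intro \<Phi>P) auto
      \<comment> \<open>Outside \<open>span I\<close> only the first and the \<open>k\<close>-th
        part occur, so there the latter is the complement of the former.\<close>
      have "a \<in> \<Phi> k \<longleftrightarrow> qproj I a \<in> ?Q - \<Psi>" if a: "a \<in> P" "a \<notin> span I" for a
      proof -
        obtain i where i: "i \<in> {1..n}" "a \<in> \<Phi> i" using a un by blast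
        have "i = 1 \<or> i = k" using others[of i] i a by (cases "i = 1") auto
        then have "a \<in> \<Phi> k \<longleftrightarrow> a \<notin> \<Phi> 1" using i dis[of 1 k] k 1 by auto
        moreover have "qproj I a \<in> ?Q" using a pos_quot[OF IS'] by blast
        ultimately show ?thesis using mem a by blast
      qed
      moreover have "qproj I a \<notin> ?Q" if "a \<in> span I" for a
        using that by (auto simp: pos_def quot_rs_def qproj_eq_0_iff)
      moreover have "\<sigma> 2 = k" by (simp add: \<sigma>_def)
      ultimately show ?thesis using kP unfolding infl_def X_def by auto
    qed
    moreover have "\<forall>i\<in>{3..n}. \<Phi> (\<sigma> i) = infl R S I {} (X i)"
    proof
      fix i assume i: "i \<in> {3..n}"
      then have "\<sigma> i \<in> {2..n}" "\<sigma> i \<noteq> k" using \<sigma>in[of i] by (auto simp: \<sigma>_def)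
      then have "\<Phi> (\<sigma> i) \<subseteq> span I" by (rule others)
      then show "\<Phi> (\<sigma> i) = infl R S I {} (X i)" by (auto simp: infl_def X_def)
    qed
    ultimately show ?thesis by blast
  qed
qed

end
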